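(* Let $\mathbb{K}$ be a field, let $\Delta$ be a $d$-dimensional pure simplicial complex on vertex set $[n]$ with $d\ge 1$, let $a>1$ be an integer, $L=x_1+\dots+x_n\in R=\mathbb{K}[x_1,\dots,x_n]$ and $J=I_\Delta+(x_1^a,\dots,x_n^a)$. Then the matrix representing the multiplication map $\times L:(R/J)_{d(a-1)}\to(R/J)_{d(a-1)+1}$ (with respect to the monomial bases) is the log matrix of the facet ideal $\mathcal{F}(\mathrm{hesd}(\Delta(d),a-1))$, up to the labelling of rows and columns: there are bijections from the nonzero monomials of $R/J$ of degree $d(a-1)$ to the vertices of $\mathrm{hesd}(\Delta(d),a-1)$, and from the nonzero monomials of $R/J$ of degree $d(a-1)+1$ to the facets of $\mathrm{hesd}(\Delta(d),a-1)$, under which the two matrices coincide.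
   Context: $I_\Delta=(\prod_{i\in\sigma}x_i:\sigma\notin\Delta)\subset R$ is the Stanley-Reisner ideal; every element of $[n]$ is a vertex of $\Delta$. A complex is pure if all its facets (maximal faces) have the same dimension. Matrix of $\times L$: rows are indexed by the nonzero monomials of the target degree, columns by the nonzero monomials of the source degree. Facet ideal: for a complex $\Gamma$ with facets $F_1,\dots,F_s$, $\mathcal{F}(\Gamma)=(\prod_{i\in F_1}x_i,\dots,\prod_{i\in F_s}x_i)$ in the polynomial ring on the vertices of $\Gamma$. Log matrix: for a monomial ideal $I$ with minimal generators $m_1,\dots,m_s$, $m_i=\prod_j x_j^{a_{ij}}$, $\log(I)$ is the matrix with entries $\log(I)_{ij}=a_{ij}$ (rows: generators, columns: variables). Incidence complex: for $1\le i\le d$, $\Delta(i)$ is the complex whose vertices are the $(i-1)$-dimensional faces of $\Delta$, and whose facets are the sets consisting of all $(i-1)$-faces of an $i$-dimensional face of $\Delta$ (one facet for each $i$-face). Any two distinct facets of $\Delta(i)$ share at most one vertex. Half-hollow edgewise subdivision: let $\Gamma$ be a simplicial complex with vertex set $[N]$ in which any two distinct facets meet in at most one vertex, and let $r>0$. Let $\mathbf{e}_1,\dots,\mathbf{e}_N$ be the standard basis of $\mathbb{R}^N$, and $\mathrm{supp}(\mathbf{a})=\{i:a_i\ne0\}$. The complex $\mathrm{hesd}(\Gamma,r)$ has as facets the sets $\{\mathbf{a}+\mathbf{e}_i:i\in F\}$, where $F$ ranges over the facets of $\Gamma$ and $\mathbf{a}$ over the vectors in $\mathbb{Z}_{\ge0}^N$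 with $\mathrm{supp}(\mathbf{a})\subseteq F$ and $a_1+\dots+a_N=r-1$. Its vertices are the vectors $\mathbf{b}\in\mathbb{Z}_{\ge 0}^N$ with $b_1+\dots+b_N=r$ whose support is contained in a facet of $\Gamma$. *)

theory Defs
  imports "HOL-Library.Poly_Mapping" "HOL-Library.FuncSet"
    "HOL-Algebra.QuotRing" "HOL-Algebra.Module"
begin

section \<open>Simplicial complexes\<close>

text \<open>A complex is represented by the set of all its faces (the empty face included); every
  element of the vertex set is a vertex of the complex.\<close>

definition simplicial_complex :: "'v set \<Rightarrow> 'v set set \<Rightarrow> bool" where
  "simplicial_complex V \<Delta> \<longleftrightarrow>
     finite V \<and> \<Delta> \<subseteq> Pow V \<and> {} \<in> \<Delta> \<and> (\<forall>v\<in>V. {v} \<in> \<Delta>) \<and>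
     (\<forall>F\<in>\<Delta>. \<forall>G. G \<subseteq> F \<longrightarrow> G \<in> \<Delta>)"

definition vertices :: "'v set set \<Rightarrow> 'v set" where
  "vertices \<Delta> = \<Union>\<Delta>"

definition facets :: "'v set set \<Rightarrow> 'v set set" where
  "facets \<Delta> = {F\<in>\<Delta>. \<forall>G\<in>\<Delta>. F \<subseteq> G \<longrightarrow> F = G}"

definition face_dim :: "'v set \<Rightarrow> int" where
  "face_dim F = int (card F) - 1"

definition complex_dim :: "'v set set \<Rightarrow> int" where
  "complex_dim \<Delta> = Max (face_dim ` \<Delta>)"

definition pure :: "'v set set \<Rightarrow> bool" where
  "pure \<Delta> \<longleftrightarrow> (\<forall>F\<in>facets \<Delta>. \<forall>G\<in>facets \<Delta>. face_dim F = face_dim G)"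

definition generated_complex :: "'v set set \<Rightarrow> 'v set set" where
  "generated_complex \<S> = {G. \<exists>F\<in>\<S>. G \<subseteq> F}"

text \<open>The incidence complex $\Delta(i)$, for $1 \le i \le \dim\Delta$. For pure $\Delta$ every
  $(i-1)$-face lies in an $i$-face, so all $(i-1)$-faces of $\Delta$ are vertices of $\Delta(i)$.\<close>

definition incidence_complex :: "'v set set \<Rightarrow> nat \<Rightarrow> 'v set set set" where
  "incidence_complex \<Delta> i =
     generated_complex {{E\<in>\<Delta>. E \<subseteq> F \<and> face_dim E = int i - 1} | F. F \<in> \<Delta> \<and> face_dim F = int i}"

text \<open>Vectors in $\mathbb{Z}_{\ge 0}^N$ are finitely supported functions on the vertices: the
  support of a vector \<open>b\<close> is \<open>keys b\<close>, and the basis vector at \<open>v\<close> is \<open>single v 1\<close>. The same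
  encoding is used for exponent vectors, where \<open>weight\<close> is the total degree.\<close>

definition weight :: "('v \<Rightarrow>\<^sub>0 nat) \<Rightarrow> nat" where
  "weight b = (\<Sum>v\<in>Poly_Mapping.keys b. Poly_Mapping.lookup b v)"

text \<open>The condition \<open>weight b + 1 = r\<close> is $b_1 + \dots + b_N = r-1$ without truncated
  subtraction. The construction is meant for $r > 0$ and for complexes \<open>\<Gamma>\<close> in which distinct
  facets share at most one vertex.\<close>

definition hesd :: "'v set set \<Rightarrow> nat \<Rightarrow> ('v \<Rightarrow>\<^sub>0 nat) set set" where
  "hesd \<Gamma> r =
     generated_complex {(\<lambda>v. b + Poly_Mapping.single v 1) ` F | F b.
       F \<in> facets \<Gamma> \<and> Poly_Mapping.keys b \<subseteq> F \<and> weight b + 1 = r}"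

section \<open>Polynomial rings and monomial ideals\<close>

type_synonym ('v, 'k) mpoly = "('v \<Rightarrow>\<^sub>0 nat) \<Rightarrow>\<^sub>0 'k"

definition poly_ring :: "'v set \<Rightarrow> ('v, 'k::field) mpoly ring" where
  "poly_ring V =
     \<lparr>carrier = {p. \<forall>m\<in>Poly_Mapping.keys p. Poly_Mapping.keys m \<subseteq> V},
      mult = (*), one = 1, zero = 0, add = (+)\<rparr>"

definition mon :: "('v \<Rightarrow>\<^sub>0 nat) \<Rightarrow> ('v, 'k::field) mpoly" where
  "mon m = Poly_Mapping.single m 1"

definition var :: "'v \<Rightarrow> ('v, 'k::field) mpoly" where
  "var v = mon (Poly_Mapping.single v 1)"

definition const :: "'k \<Rightarrow> ('v, 'k::field) mpoly" where
  "const c = Poly_Mapping.single 0 c"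

definition homogeneous :: "nat \<Rightarrow> ('v, 'k::field) mpoly \<Rightarrow> bool" where
  "homogeneous j p \<longleftrightarrow> (\<forall>m\<in>Poly_Mapping.keys p. weight m = j)"

definition stanley_reisner_ideal :: "'v set \<Rightarrow> 'v set set \<Rightarrow> ('v, 'k::field) mpoly set" where
  "stanley_reisner_ideal V \<Delta> = Idl\<^bsub>poly_ring V\<^esub> {\<Prod>v\<in>\<sigma>. var v | \<sigma>. \<sigma> \<subseteq> V \<and> \<sigma> \<notin> \<Delta>}"

definition pure_power_ideal :: "'v set \<Rightarrow> nat \<Rightarrow> ('v, 'k::field) mpoly set" where
  "pure_power_ideal V a = Idl\<^bsub>poly_ring V\<^esub> {var v ^ a | v. v \<in> V}"

definition facet_ideal :: "'v set set \<Rightarrow> ('v, 'k::field) mpoly set" where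
  "facet_ideal \<Gamma> = Idl\<^bsub>poly_ring (vertices \<Gamma>)\<^esub> {\<Prod>v\<in>F. var v | F. F \<in> facets \<Gamma>}"

text \<open>Exponent vectors of the minimal monomial generators of a monomial ideal, i.e. of the
  monomials of the ideal that are minimal with respect to divisibility.\<close>

definition minimal_generators :: "('v, 'k::field) mpoly set \<Rightarrow> ('v \<Rightarrow>\<^sub>0 nat) set" where
  "minimal_generators I =
     {m. mon m \<in> I \<and>
         (\<forall>m'. mon m' \<in> I \<and> (\<forall>v. Poly_Mapping.lookup m' v \<le> Poly_Mapping.lookup m v) \<longrightarrow> m' = m)}"

text \<open>Rows are indexed by the minimal generators themselves, columns by the variables.\<close>

definition log_matrix :: "('v, 'k::field) mpoly set \<Rightarrow> ('v \<Rightarrow>\<^sub>0 nat) \<Rightarrow> 'v \<Rightarrow> nat" where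
  "log_matrix I = (\<lambda>m\<in>minimal_generators I. \<lambda>v. Poly_Mapping.lookup m v)"

text \<open>Exponent vector of the squarefree monomial $\prod_{v \in F} x_v$.\<close>

definition face_exponent :: "'v set \<Rightarrow> ('v \<Rightarrow>\<^sub>0 nat)" where
  "face_exponent F = (\<Sum>v\<in>F. Poly_Mapping.single v 1)"

section \<open>Quotients of polynomial rings\<close>

text \<open>The ring $R/J$, $R = K[x_v : v \in V]$, as an algebra over $K$; its elements are the cosets
  of \<open>J\<close>, and a scalar acts through the image of the constant polynomial.\<close>

definition quotient_algebra ::
    "'v set \<Rightarrow> ('v, 'k::field) mpoly set \<Rightarrow> ('k, ('v, 'k) mpoly set) module" where
  "quotient_algebra V J =
     \<lparr>carrier = carrier (poly_ring V Quot J),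
      mult = mult (poly_ring V Quot J),
      one = one (poly_ring V Quot J),
      zero = zero (poly_ring V Quot J),
      add = add (poly_ring V Quot J),
      smult = (\<lambda>c X. (J +>\<^bsub>poly_ring V\<^esub> const c) \<otimes>\<^bsub>poly_ring V Quot J\<^esub> X)\<rparr>"

definition graded_component ::
    "'v set \<Rightarrow> ('v, 'k::field) mpoly set \<Rightarrow> nat \<Rightarrow> ('v, 'k) mpoly set set" where
  "graded_component V J j =
     {J +>\<^bsub>poly_ring V\<^esub> f | f. f \<in> carrier (poly_ring V) \<and> homogeneous j f}"

definition nonzero_monomials ::
    "'v set \<Rightarrow> ('v, 'k::field) mpoly set \<Rightarrow> nat \<Rightarrow> ('v, 'k) mpoly set set" where
  "nonzero_monomials V J j =
     {J +>\<^bsub>poly_ring V\<^esub> mon m | m. Poly_Mapping.keys m \<subseteq> V \<and> weight m = j}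
       - {\<zero>\<^bsub>quotient_algebra V J\<^esub>}"

section \<open>Matrices of linear maps\<close>

definition lin_comb :: "('k, 'b) module \<Rightarrow> 'b set \<Rightarrow> ('b \<Rightarrow> 'k) \<Rightarrow> 'b" where
  "lin_comb M B c = (\<Oplus>\<^bsub>M\<^esub>b\<in>B. c b \<odot>\<^bsub>M\<^esub> b)"

definition finite_basis :: "('k::field, 'b) module \<Rightarrow> 'b set \<Rightarrow> 'b set \<Rightarrow> bool" where
  "finite_basis M U B \<longleftrightarrow>
     finite B \<and> B \<subseteq> U \<and> U = range (lin_comb M B) \<and>
     (\<forall>c. lin_comb M B c = \<zero>\<^bsub>M\<^esub> \<longrightarrow> (\<forall>b\<in>B. c b = 0))"

definition linear_on :: "('k::field, 'b) module \<Rightarrow> 'b set \<Rightarrow> 'b set \<Rightarrow> ('b \<Rightarrow> 'b) \<Rightarrow> bool" where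
  "linear_on M U W T \<longleftrightarrow>
     T \<in> U \<rightarrow> W \<and>
     (\<forall>x\<in>U. \<forall>y\<in>U. T (x \<oplus>\<^bsub>M\<^esub> y) = T x \<oplus>\<^bsub>M\<^esub> T y) \<and>
     (\<forall>c. \<forall>x\<in>U. T (c \<odot>\<^bsub>M\<^esub> x) = c \<odot>\<^bsub>M\<^esub> T x)"

text \<open>\<open>A\<close> is the matrix of the linear map \<open>T\<close> from \<open>U\<close> to \<open>W\<close> (subspaces of \<open>M\<close>) with respect to
  the bases \<open>B\<close> of \<open>U\<close> and \<open>C\<close> of \<open>W\<close>. Rows are indexed by \<open>C\<close> and columns by \<open>B\<close>: the entry
  \<open>A y x\<close> is the coefficient of \<open>y\<close> in \<open>T x\<close>.\<close>

definition represents ::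
    "('k::field, 'b) module \<Rightarrow> 'b set \<Rightarrow> 'b set \<Rightarrow> 'b set \<Rightarrow> 'b set \<Rightarrow>
     ('b \<Rightarrow> 'b \<Rightarrow> 'k) \<Rightarrow> ('b \<Rightarrow> 'b) \<Rightarrow> bool" where
  "represents M U B W C A T \<longleftrightarrow>
     finite_basis M U B \<and> finite_basis M W C \<and> linear_on M U W T \<and>
     (\<forall>x\<in>B. T x = lin_comb M C (\<lambda>y. A y x))"

end

(* Identify the monomials of degree d(a-1) with nonnegative integer vectors b of weight a-1 on the
   (d-1)-faces of a d-face F by sending b to the product of the faces E^b(E): on the variables of F
   the exponent of x_v is a - 1 - b(F - v), so b is recovered from its monomial once F is known, and
   if F is not determined then b is supported on a single (d-1)-face. A nonzero monomial of degree
   d(a-1)+1 needs more than d variables, so its support is a d-face F, and it is x_F times the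
   monomial of a vector b of weight a-2; its divisors of degree d(a-1) are the monomials of
   b + e_(F - v) for v in F, which are the vertices of one facet of the subdivision. *)

theory Submission
  imports Defs
begin

section \<open>Monomial ideals\<close>

text \<open>The degree comes from complements. On a \<open>d\<close>-face F the largest monomial
  outside J is x_F^(a-1), of degree (d+1)(a-1). A monomial on F of degree d(a-1) therefore leaves a
  complement of degree a-1, and one of degree d(a-1)+1 a complement of degree a-2: the weights of
  the vertices of the subdivision and of the vectors that produce its facets. The obstacle is that
  the complement depends on F. A monomial of degree d(a-1) that fails to determine F misses a vertex
  v of F, so the other d exponents are all a-1 and the complement is concentrated at v. Recording it
  at the ridge F - {v}, which is then the support of the monomial, removes the dependence on F;
  vectors on (d-1)-faces achieve exactly this. On the algebraic side, J is spanned by the monomials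
  it contains, so identities in R/J reduce to comparing coefficients at monomials outside J, and an
  entry is 1 exactly when the row monomial is the column monomial times a variable.\<close>

lemma poly_ring_simps [simp]:
  "carrier (poly_ring V) = {p. \<forall>m\<in>Poly_Mapping.keys p. Poly_Mapping.keys m \<subseteq> V}"
  "mult (poly_ring V) = (*)" "one (poly_ring V) = 1"
  "zero (poly_ring V) = 0" "add (poly_ring V) = (+)"
  by (simp_all add: poly_ring_def)

text \<open>Natural exponents cannot cancel, which turns the inclusion valid for arbitrary
  coefficients into an equality. This is what lets divisibility by squarefree monomials be read off
  supports.\<close>

lemma keys_add_nat:
  "Poly_Mapping.keys (m + m' :: 'v \<Rightarrow>\<^sub>0 nat) = Poly_Mapping.keys m \<union> Poly_Mapping.keys m'"
  by (auto simp: in_keys_iff lookup_add)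

lemma keys_sum_nat:
  "finite A \<Longrightarrow> Poly_Mapping.keys (\<Sum>i\<in>A. f i :: 'v \<Rightarrow>\<^sub>0 nat) = (\<Union>i\<in>A. Poly_Mapping.keys (f i))"
  by (induction A rule: finite_induct) (auto simp: keys_add_nat)

text \<open>Stated with \<open>Suc 0\<close>, the form into which the simplifier rewrites the
  natural number 1.\<close>

lemma single_one_eq_iff [simp]:
  "Poly_Mapping.single v (Suc 0) = Poly_Mapping.single w (Suc 0) \<longleftrightarrow> v = w"
proof
  assume "Poly_Mapping.single v (Suc 0) = Poly_Mapping.single w (Suc 0)"
  then have "Poly_Mapping.keys (Poly_Mapping.single v (Suc 0)) =
      Poly_Mapping.keys (Poly_Mapping.single w (Suc 0))" by (rule arg_cong)
  then show "v = w" by simp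
qed simp

section \<open>Degrees of exponent vectors and expansion into terms\<close>

lemma weight_superset:
  assumes "finite A" "Poly_Mapping.keys b \<subseteq> A"
  shows "weight b = (\<Sum>v\<in>A. Poly_Mapping.lookup b v)"
  unfolding weight_def by (rule sum.mono_neutral_left) (use assms in \<open>auto simp: in_keys_iff\<close>)

lemma weight_add: "weight (b + c) = weight b + weight c"
proof -
  let ?A = "Poly_Mapping.keys b \<union> Poly_Mapping.keys c"
  have "weight (b + c) = (\<Sum>v\<in>?A. Poly_Mapping.lookup (b + c) v)"
    by (rule weight_superset) (simp_all add: keys_add_nat)
  also have "\<dots> = weight b + weight c"
    by (simp add: lookup_add sum.distrib weight_superset[of ?A])
  finally show ?thesis .
qed

lemma weight_single: "weight (Poly_Mapping.single v k) = k"
  by (cases "k = 0") (simp_all add: weight_def)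

lemma weight_zero: "weight 0 = 0"
  by (simp add: weight_def)

lemma weight_sum: "weight (\<Sum>i\<in>A. f i) = (\<Sum>i\<in>A. weight (f i))"
  by (induction A rule: infinite_finite_induct) (simp_all add: weight_zero weight_add)

lemma lookup_le_weight: "Poly_Mapping.lookup b v \<le> weight b"
  by (cases "v \<in> Poly_Mapping.keys b")
    (auto simp: weight_def in_keys_iff intro: member_le_sum)

lemma sum_single_lookup:
  fixes p :: "'a \<Rightarrow>\<^sub>0 'b::comm_monoid_add"
  assumes "finite A" "Poly_Mapping.keys p \<subseteq> A"
  shows "(\<Sum>m\<in>A. Poly_Mapping.single m (Poly_Mapping.lookup p m)) = p"
proof (rule poly_mapping_eqI)
  fix k
  have "(\<Sum>m\<in>A. Poly_Mapping.lookup (Poly_Mapping.single m (Poly_Mapping.lookup p m)) k)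
      = (\<Sum>m\<in>A. if m = k then Poly_Mapping.lookup p m else 0)"
    by (intro sum.cong) (auto simp: lookup_single)
  then show "Poly_Mapping.lookup (\<Sum>m\<in>A. Poly_Mapping.single m (Poly_Mapping.lookup p m)) k
      = Poly_Mapping.lookup p k"
    using assms by (auto simp: lookup_sum in_keys_iff)
qed

lemma lookup_sum_single:
  assumes "finite A"
  shows "Poly_Mapping.lookup (\<Sum>m\<in>A. Poly_Mapping.single m (c m)) k = (if k \<in> A then c k else 0)"
proof -
  have "(\<Sum>m\<in>A. Poly_Mapping.lookup (Poly_Mapping.single m (c m)) k)
      = (\<Sum>m\<in>A. if m = k then c m else 0)"
    by (intro sum.cong) (auto simp: lookup_single)
  then show ?thesis
    using assms by (simp add: lookup_sum)
qed

section \<open>The polynomial ring on V as a commutative ring\<close>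

lemma poly_ring_add_closed:
  fixes x y :: "('v, 'k::field) mpoly"
  assumes "x \<in> carrier (poly_ring V)" "y \<in> carrier (poly_ring V)"
  shows "x + y \<in> carrier (poly_ring V)"
  using assms keys_add[of x y] by auto

lemma poly_ring_mult_closed:
  fixes x y :: "('v, 'k::field) mpoly"
  assumes "x \<in> carrier (poly_ring V)" "y \<in> carrier (poly_ring V)"
  shows "x * y \<in> carrier (poly_ring V)"
  using assms keys_mult[of x y] by (fastforce simp: keys_add_nat)

lemma poly_ring_uminus_closed:
  "x \<in> carrier (poly_ring V) \<Longrightarrow>
    - x \<in> (carrier (poly_ring V) :: ('v, 'k::field) mpoly set)"
  by (auto simp: in_keys_iff)

lemma poly_ring_sum_closed:
  "(\<And>i. i \<in> A \<Longrightarrow> f i \<in> carrier (poly_ring V)) \<Longrightarrow>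
    sum f A \<in> (carrier (poly_ring V) :: ('v, 'k::field) mpoly set)"
proof (induction A rule: infinite_finite_induct)
  case (insert x A)
  then have "f x + sum f A \<in> carrier (poly_ring V)"
    by (intro poly_ring_add_closed) blast+
  with insert show ?case by (simp del: poly_ring_simps)
qed simp_all

lemma cring_poly_ring: "cring (poly_ring V :: ('v, 'k::field) mpoly ring)"
proof (rule cringI)
  let ?R = "poly_ring V :: ('v, 'k) mpoly ring"
  show "abelian_group ?R"
  proof (rule abelian_groupI)
    fix x assume "x \<in> carrier ?R"
    then show "\<exists>y\<in>carrier ?R. y \<oplus>\<^bsub>?R\<^esub> x = \<zero>\<^bsub>?R\<^esub>"
      using poly_ring_uminus_closed by (intro bexI[of _ "- x"]) auto
  next
    fix x y assume "x \<in> carrier ?R" "y \<in> carrier ?R"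
    then show "x \<oplus>\<^bsub>?R\<^esub> y \<in> carrier ?R" using poly_ring_add_closed[of x V y] by simp
  qed (simp_all add: add.assoc add.commute)
  show "Group.comm_monoid ?R"
  proof (rule comm_monoidI)
    fix x y assume "x \<in> carrier ?R" "y \<in> carrier ?R"
    then show "x \<otimes>\<^bsub>?R\<^esub> y \<in> carrier ?R" using poly_ring_mult_closed[of x V y] by simp
  qed (simp_all add: mult.assoc mult.commute)
qed (simp add: distrib_right)

lemma ring_poly_ring: "ring (poly_ring V :: ('v, 'k::field) mpoly ring)"
  by (rule cring.axioms(1)[OF cring_poly_ring])

section \<open>Ideals spanned by monomials\<close>

definition monomial_span :: "'v set \<Rightarrow> ('v \<Rightarrow>\<^sub>0 nat) set \<Rightarrow> ('v, 'k::field) mpoly set" where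
  "monomial_span V D = {p \<in> carrier (poly_ring V). Poly_Mapping.keys p \<subseteq> D}"

text \<open>Each exponent of a product is an exponent of one factor plus some vector, so upward
  closure of \<open>D\<close> suffices. \<open>D\<close> may contain vectors with variables outside
  \<open>V\<close>; the carrier condition discards them.\<close>

lemma ideal_monomial_span:
  assumes "\<And>m m'. m \<in> D \<Longrightarrow> m + m' \<in> D"
  shows "ideal (monomial_span V D :: ('v, 'k::field) mpoly set) (poly_ring V)"
proof (rule idealI[OF ring_poly_ring])
  interpret cring "poly_ring V :: ('v, 'k) mpoly ring" by (rule cring_poly_ring)
  let ?R = "poly_ring V :: ('v, 'k) mpoly ring"
  let ?I = "monomial_span V D :: ('v, 'k) mpoly set"
  have minus: "\<ominus>\<^bsub>?R\<^esub> x = - x" if "x \<in> carrier ?R" for x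
    using that by (intro minus_equality) (auto simp: in_keys_iff)
  show "subgroup ?I (add_monoid ?R)"
  proof (rule add.subgroupI)
    show "?I \<noteq> {}" by (auto simp: monomial_span_def intro: exI[of _ 0])
    show "\<ominus>\<^bsub>?R\<^esub> x \<in> ?I" if "x \<in> ?I" for x
    proof -
      from that have "\<ominus>\<^bsub>?R\<^esub> x = - x" by (intro minus) (simp add: monomial_span_def)
      with that show ?thesis by (auto simp: monomial_span_def in_keys_iff)
    qed
    show "x \<oplus>\<^bsub>?R\<^esub> y \<in> ?I" if "x \<in> ?I" "y \<in> ?I" for x y
      using that keys_add[of x y] poly_ring_add_closed[of x V y] by (auto simp: monomial_span_def)
  qed (auto simp: monomial_span_def)
  fix p q assume p: "p \<in> ?I" and q: "q \<in> carrier ?R"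
  then have "p * q \<in> carrier ?R"
    by (intro poly_ring_mult_closed) (simp_all add: monomial_span_def)
  moreover have "Poly_Mapping.keys (p * q) \<subseteq> D"
  proof
    fix m assume "m \<in> Poly_Mapping.keys (p * q)"
    then obtain l l' where "m = l + l'" "l \<in> Poly_Mapping.keys p"
      using keys_mult[of p q] by blast
    then show "m \<in> D" using p assms by (auto simp: monomial_span_def)
  qed
  ultimately have "p * q \<in> ?I" by (simp add: monomial_span_def)
  then show "p \<otimes>\<^bsub>?R\<^esub> q \<in> ?I" "q \<otimes>\<^bsub>?R\<^esub> p \<in> ?I" by (simp_all add: mult.commute)
qed

text \<open>A polynomial is the sum of its terms. This direction holds for every ideal, so it
  applies to generated ideals and sums of ideals before they are known to be monomial spans.\<close>

lemma mem_ideal_of_terms: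
  fixes p :: "('v, 'k::field) mpoly"
  assumes "ideal I (poly_ring V)"
    and "\<And>m. m \<in> Poly_Mapping.keys p \<Longrightarrow> Poly_Mapping.single m (Poly_Mapping.lookup p m) \<in> I"
  shows "p \<in> I"
proof -
  interpret ideal I "poly_ring V" by fact
  have "(\<Sum>m\<in>A. Poly_Mapping.single m (Poly_Mapping.lookup p m)) \<in> I"
    if "finite A" "A \<subseteq> Poly_Mapping.keys p" for A
    using that
  proof (induction A rule: finite_induct)
    case empty
    then show ?case using additive_subgroup.zero_closed[OF additive_subgroup_axioms] by simp
  next
    case (insert m A)
    then show ?case
      using additive_subgroup.a_closed[OF additive_subgroup_axioms] assms(2)[of m] by simp
  qed
  from this[OF finite_keys order_refl] show ?thesis
    by (simp add: sum_single_lookup)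
qed

lemma genideal_monomials:
  assumes "\<And>m. m \<in> G \<Longrightarrow> Poly_Mapping.keys m \<subseteq> V"
  shows "Idl\<^bsub>poly_ring V\<^esub> (mon ` G) =
    (monomial_span V {m. \<exists>g\<in>G. \<exists>l. m = g + l} :: ('v, 'k::field) mpoly set)"
proof
  interpret ring "poly_ring V :: ('v, 'k) mpoly ring" by (rule ring_poly_ring)
  let ?D = "{m. \<exists>g\<in>G. \<exists>l. m = g + l}"
  let ?Idl = "Idl\<^bsub>poly_ring V\<^esub> (mon ` G) :: ('v, 'k) mpoly set"
  have gens: "(mon ` G :: ('v, 'k) mpoly set) \<subseteq> carrier (poly_ring V)"
    using assms by (fastforce simp: mon_def)
  have idl: "ideal ?Idl (poly_ring V)"
    by (rule genideal_ideal[OF gens])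
  have "ideal (monomial_span V ?D :: ('v, 'k) mpoly set) (poly_ring V)"
  proof (rule ideal_monomial_span)
    fix m m' assume "m \<in> ?D"
    then obtain g l where "m = g + l" "g \<in> G" by blast
    then have "m + m' = g + (l + m')" "g \<in> G" by (simp_all add: add.assoc)
    then show "m + m' \<in> ?D" by blast
  qed
  moreover have "(mon ` G :: ('v, 'k) mpoly set) \<subseteq> monomial_span V ?D"
  proof
    fix p :: "('v, 'k) mpoly" assume "p \<in> mon ` G"
    then obtain m where m: "m \<in> G" "p = mon m" by blast
    then have "m \<in> ?D" by (intro CollectI bexI[of _ m] exI[of _ 0]) simp_all
    then show "p \<in> monomial_span V ?D" using m assms by (auto simp: monomial_span_def mon_def)
  qed
  ultimately show "?Idl \<subseteq> monomial_span V ?D"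
    by (rule genideal_minimal)
  show "monomial_span V ?D \<subseteq> ?Idl"
  proof
    fix p :: "('v, 'k) mpoly" assume p: "p \<in> monomial_span V ?D"
    show "p \<in> ?Idl"
    proof (rule mem_ideal_of_terms[OF idl])
      fix k assume k: "k \<in> Poly_Mapping.keys p"
      then obtain m m' where m: "k = m + m'" "m \<in> G" using p by (auto simp: monomial_span_def)
      \<comment> \<open>The cofactor has to lie in the ring on \<open>V\<close>; its support is
        contained in that of \<open>k\<close>.\<close>
      have m': "Poly_Mapping.keys m' \<subseteq> V"
      proof -
        have "Poly_Mapping.keys k \<subseteq> V" using p k by (auto simp: monomial_span_def)
        then show ?thesis by (simp add: m(1) keys_add_nat)
      qed
      have "mon m \<in> ?Idl" by (rule subsetD[OF genideal_self[OF gens] imageI[OF m(2)]])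
      moreover have "Poly_Mapping.single m' (Poly_Mapping.lookup p k) \<in> carrier (poly_ring V)"
        using m' by simp
      ultimately have
        "mon m \<otimes>\<^bsub>poly_ring V\<^esub> Poly_Mapping.single m' (Poly_Mapping.lookup p k) \<in> ?Idl"
        by (rule ideal.I_r_closed[OF idl])
      then show "Poly_Mapping.single k (Poly_Mapping.lookup p k) \<in> ?Idl"
        by (simp add: mon_def mult_single m)
    qed
  qed
qed

text \<open>Each single term of a polynomial on the right lies in one of the two spans, so it is a
  sum with the other summand 0.\<close>

lemma monomial_span_set_add:
  assumes "\<And>m m'. m \<in> D \<Longrightarrow> m + m' \<in> D" and "\<And>m m'. m \<in> E \<Longrightarrow> m + m' \<in> E"
  shows "monomial_span V D <+>\<^bsub>poly_ring V\<^esub> monomial_span V E =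
    (monomial_span V (D \<union> E) :: ('v, 'k::field) mpoly set)" (is "?l = ?r")
proof
  interpret ring "poly_ring V :: ('v, 'k) mpoly ring" by (rule ring_poly_ring)
  show "?l \<subseteq> ?r"
  proof
    fix z assume "z \<in> ?l"
    then obtain x y where z: "z = x + y" "x \<in> monomial_span V D" "y \<in> monomial_span V E"
      by (auto simp: set_add_def')
    then show "z \<in> ?r" using poly_ring_add_closed[of x V y] keys_add[of x y] by (auto simp: monomial_span_def)
  qed
  have ideal: "ideal ?l (poly_ring V)"
    using assms by (intro add_ideals ideal_monomial_span) auto
  show "?r \<subseteq> ?l"
  proof
    fix p :: "('v, 'k) mpoly" assume p: "p \<in> ?r"
    show "p \<in> ?l"
    proof (rule mem_ideal_of_terms[OF ideal])
      fix m assume m: "m \<in> Poly_Mapping.keys p"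
      let ?t = "Poly_Mapping.single m (Poly_Mapping.lookup p m)"
      have V: "Poly_Mapping.keys m \<subseteq> V" using p m by (auto simp: monomial_span_def)
      have z: "0 \<in> monomial_span V D" "0 \<in> monomial_span V E"
        by (auto simp: monomial_span_def)
      consider "m \<in> D" | "m \<in> E" using p m by (auto simp: monomial_span_def)
      then have "(\<exists>x\<in>monomial_span V D. \<exists>y\<in>monomial_span V E. ?t = x + y)"
      proof cases
        case 1
        then have "?t \<in> monomial_span V D" using V by (simp add: monomial_span_def)
        then show ?thesis using z by (metis add.right_neutral)
      next
        case 2
        then have "?t \<in> monomial_span V E" using V by (simp add: monomial_span_def)
        then show ?thesis using z by (metis add.left_neutral)
      qed
      then show "?t \<in> ?l" by (auto simp: set_add_def')
    qed
  qed
qed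

section \<open>Quotients by monomial ideals\<close>

text \<open>Taking \<open>J\<close> as a parameter tied to \<open>D\<close> by \<open>J_eq\<close>
  lets the results speak of the ideal in whatever form it was given, while all computations use only
  the exponents in \<open>D\<close>.\<close>

locale monomial_quotient =
  fixes V :: "'v set" and D :: "('v \<Rightarrow>\<^sub>0 nat) set" and J :: "('v, 'k::field) mpoly set"
  assumes finite_V: "finite V"
    and upset: "\<And>m m'. m \<in> D \<Longrightarrow> m + m' \<in> D"
    and J_eq: "J = monomial_span V D"
begin

abbreviation R :: "('v, 'k) mpoly ring" where "R \<equiv> poly_ring V"

abbreviation Q :: "('k, ('v, 'k) mpoly set) module" where "Q \<equiv> quotient_algebra V J"

abbreviation coset :: "('v, 'k) mpoly \<Rightarrow> ('v, 'k) mpoly set" where "coset f \<equiv> J +>\<^bsub>R\<^esub> f"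

definition standard :: "nat \<Rightarrow> ('v \<Rightarrow>\<^sub>0 nat) set" where
  "standard j = {m. Poly_Mapping.keys m \<subseteq> V \<and> m \<notin> D \<and> weight m = j}"

sublocale cring R
  by (rule cring_poly_ring)

sublocale ideal J R
  unfolding J_eq using upset by (rule ideal_monomial_span)

sublocale quot: cring "R Quot J"
  by (rule quotient_is_cring) (rule cring_poly_ring)

text \<open>\<open>Q\<close> is a copy of \<open>R Quot J\<close> in a record with scalars; these
  equations send its operations back to the ring, where the algebraic laws are available.\<close>

lemma Q_simps:
  "carrier Q = carrier (R Quot J)" "mult Q = mult (R Quot J)" "zero Q = zero (R Quot J)"
  "add Q = add (R Quot J)" "smult Q c X = coset (const c) \<otimes>\<^bsub>R Quot J\<^esub> X"
  by (simp_all add: quotient_algebra_def)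

lemma coset_closed: "f \<in> carrier R \<Longrightarrow> coset f \<in> carrier (R Quot J)"
  by (rule ring_hom_closed[OF rcos_ring_hom])

lemma coset_add:
  "f \<in> carrier R \<Longrightarrow> g \<in> carrier R \<Longrightarrow> coset f \<oplus>\<^bsub>R Quot J\<^esub> coset g = coset (f + g)"
  using ring_hom_add[OF rcos_ring_hom, of f g] by simp

lemma coset_mult:
  "f \<in> carrier R \<Longrightarrow> g \<in> carrier R \<Longrightarrow> coset f \<otimes>\<^bsub>R Quot J\<^esub> coset g = coset (f * g)"
  using ring_hom_mult[OF rcos_ring_hom, of f g] by simp

lemma coset_zero: "coset 0 = \<zero>\<^bsub>R Quot J\<^esub>"
  using ring_hom_zero[OF rcos_ring_hom ring_axioms quot.ring_axioms] by simp

text \<open>The difference lies in \<open>J\<close> iff all its exponents lie in \<open>D\<close>.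
  From here on, equality in the quotient is a comparison of coefficients at exponents outside
  \<open>D\<close>.\<close>

lemma coset_eq_iff:
  assumes "f \<in> carrier R" "g \<in> carrier R"
  shows "coset f = coset g \<longleftrightarrow>
    (\<forall>m. Poly_Mapping.keys m \<subseteq> V \<longrightarrow> m \<notin> D \<longrightarrow> Poly_Mapping.lookup f m = Poly_Mapping.lookup g m)"
proof -
  have "\<ominus>\<^bsub>R\<^esub> g = - g"
    using assms(2) poly_ring_uminus_closed[OF assms(2)] by (intro minus_equality) auto
  then have diff: "f \<ominus>\<^bsub>R\<^esub> g = f - g" by (simp add: a_minus_def)
  have "coset f = coset g \<longleftrightarrow> f - g \<in> J"
    using quotient_eq_iff_same_a_r_cos[OF is_ideal assms] diff by simp
  also have "\<dots> \<longleftrightarrow> Poly_Mapping.keys (f - g) \<subseteq> D"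
    using minus_closed[OF assms] diff by (simp add: J_eq monomial_span_def)
  also have "\<dots> \<longleftrightarrow>
    (\<forall>m. Poly_Mapping.keys m \<subseteq> V \<longrightarrow> m \<notin> D \<longrightarrow> Poly_Mapping.lookup f m = Poly_Mapping.lookup g m)"
  proof
    assume "Poly_Mapping.keys (f - g) \<subseteq> D"
    then show "\<forall>m. Poly_Mapping.keys m \<subseteq> V \<longrightarrow> m \<notin> D \<longrightarrow>
        Poly_Mapping.lookup f m = Poly_Mapping.lookup g m"
      by (force simp: in_keys_iff lookup_minus)
  next
    assume *: "\<forall>m. Poly_Mapping.keys m \<subseteq> V \<longrightarrow> m \<notin> D \<longrightarrow>
        Poly_Mapping.lookup f m = Poly_Mapping.lookup g m"
    have V: "\<forall>m\<in>Poly_Mapping.keys (f - g). Poly_Mapping.keys m \<subseteq> V"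
      using minus_closed[OF assms] diff by simp
    show "Poly_Mapping.keys (f - g) \<subseteq> D"
    proof
      fix m assume m: "m \<in> Poly_Mapping.keys (f - g)"
      then have "Poly_Mapping.lookup f m \<noteq> Poly_Mapping.lookup g m"
        by (simp add: in_keys_iff lookup_minus)
      then show "m \<in> D" using * V m by blast
    qed
  qed
  finally show ?thesis .
qed

section \<open>The monomial basis of a graded component\<close>

lemma carrier_single: "Poly_Mapping.keys m \<subseteq> V \<Longrightarrow> Poly_Mapping.single m c \<in> carrier R"
  by simp

lemma carrier_mon: "Poly_Mapping.keys m \<subseteq> V \<Longrightarrow> mon m \<in> carrier R"
  by (simp add: mon_def)

lemma bij_betw_standard:
  "bij_betw (\<lambda>m. coset (mon m)) (standard j) (nonzero_monomials V J j)"
proof (rule bij_betw_imageI)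
  show "inj_on (\<lambda>m. coset (mon m)) (standard j)"
  proof (rule inj_onI)
    fix m m' assume *: "m \<in> standard j" "m' \<in> standard j" "coset (mon m) = coset (mon m')"
    then have "Poly_Mapping.lookup (mon m :: ('v, 'k) mpoly) m = Poly_Mapping.lookup (mon m') m"
      using coset_eq_iff[of "mon m" "mon m'"] carrier_mon by (auto simp: standard_def)
    then show "m = m'" by (auto simp: mon_def lookup_single when_def split: if_splits)
  qed
  have "coset (mon m) = \<zero>\<^bsub>Q\<^esub> \<longleftrightarrow> m \<in> D" if "Poly_Mapping.keys m \<subseteq> V" for m
    using that coset_eq_iff[OF carrier_mon, of m 0]
    by (auto simp: Q_simps coset_zero[symmetric] mon_def lookup_single when_def)
  then show "(\<lambda>m. coset (mon m)) ` standard j = nonzero_monomials V J j"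
    by (auto simp: nonzero_monomials_def standard_def)
qed

text \<open>No exponent exceeds the total degree, so the exponent functions lie in a finite
  box.\<close>

lemma finite_standard: "finite (standard j)"
proof -
  let ?F = "{f. \<forall>x. (x \<in> V \<longrightarrow> f x \<in> {..j}) \<and> (x \<notin> V \<longrightarrow> f x = 0)}"
  have "Poly_Mapping.lookup ` standard j \<subseteq> ?F"
    using lookup_le_weight by (fastforce simp: standard_def in_keys_iff)
  moreover have "finite ?F"
    by (rule finite_set_of_finite_funs) (use finite_V in auto)
  ultimately have "finite (Poly_Mapping.lookup ` standard j)" by (rule finite_subset)
  then show ?thesis by (rule finite_imageD) (simp add: inj_on_def lookup_inject)
qed

text \<open>A linear combination in the quotient becomes the coset of one explicit polynomial, whose
  coefficients \<open>coset_eq_iff\<close> can read. The coefficients \<open>c\<close> are indexed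
  by cosets, as the basis is.\<close>

lemma lin_comb_monomials:
  assumes "A \<subseteq> standard j"
  shows "lin_comb Q ((\<lambda>m. coset (mon m)) ` A) c
    = coset (\<Sum>m\<in>A. Poly_Mapping.single m (c (coset (mon m))))"
proof -
  let ?k = "\<lambda>m. coset (mon m)"
  have inj: "inj_on ?k A"
    using bij_betw_imp_inj_on[OF bij_betw_standard] assms by (rule inj_on_subset)
  have keysV: "Poly_Mapping.keys m \<subseteq> V" if "m \<in> A" for m
    using that assms by (auto simp: standard_def)
  have const: "const c \<in> carrier R" for c :: 'k
    by (simp add: const_def)
  have smult: "c (?k m) \<odot>\<^bsub>Q\<^esub> ?k m = coset (Poly_Mapping.single m (c (?k m)))" if "m \<in> A" for m
    using coset_mult[OF const carrier_mon[OF keysV[OF that]]]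
    by (simp add: Q_simps const_def mon_def mult_single)
  have closed: "coset (Poly_Mapping.single m (c (?k m))) \<in> carrier (R Quot J)" if "m \<in> A" for m
    using keysV[OF that] by (intro coset_closed) simp
  \<comment> \<open>\<open>finsum\<close> depends only on the carrier and the additive structure, on
    which \<open>Q\<close> and \<open>R Quot J\<close> agree.\<close>
  have "lin_comb Q (?k ` A) c = finsum (R Quot J) (\<lambda>b. c b \<odot>\<^bsub>Q\<^esub> b) (?k ` A)"
    by (simp add: lin_comb_def finsum_def finprod_def Q_simps)
  also have "\<dots> = finsum (R Quot J) (\<lambda>m. c (?k m) \<odot>\<^bsub>Q\<^esub> ?k m) A"
    by (rule quot.add.finprod_reindex[OF _ inj]) (use smult closed in auto)
  also have "\<dots> = finsum (R Quot J) (\<lambda>m. coset (Poly_Mapping.single m (c (?k m)))) A"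
    by (rule quot.finsum_cong') (use smult closed in auto)
  also have "\<dots> = coset (\<Sum>m\<in>A. Poly_Mapping.single m (c (?k m)))"
    using finite_subset[OF assms finite_standard] keysV closed
  proof (induction A rule: finite_induct)
    case empty
    then show ?case by (simp add: coset_zero)
  next
    case (insert x F)
    have "coset (Poly_Mapping.single x (c (?k x))) \<oplus>\<^bsub>R Quot J\<^esub>
        coset (\<Sum>m\<in>F. Poly_Mapping.single m (c (?k m)))
      = coset (Poly_Mapping.single x (c (?k x)) + (\<Sum>m\<in>F. Poly_Mapping.single m (c (?k m))))"
      by (rule coset_add[OF carrier_single poly_ring_sum_closed]) (use insert in auto)
    with insert show ?case
      by (simp add: quot.finsum_insert Pi_iff)
  qed
  finally show ?thesis .
qed

lemma lin_comb_nonzero_monomials: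
  "lin_comb Q (nonzero_monomials V J j) c
    = coset (\<Sum>m\<in>standard j. Poly_Mapping.single m (c (coset (mon m))))"
  using lin_comb_monomials[OF order_refl, of j c]
  unfolding bij_betw_imp_surj_on[OF bij_betw_standard] .

lemma finite_basis_nonzero_monomials:
  "finite_basis Q (graded_component V J j) (nonzero_monomials V J j)"
  unfolding finite_basis_def
proof (intro conjI allI impI)
  let ?k = "\<lambda>m. coset (mon m)"
  let ?s = "\<lambda>c. \<Sum>m\<in>standard j. Poly_Mapping.single m (c (?k m))"
  note bij = bij_betw_standard[of j]
  show "finite (nonzero_monomials V J j)"
    using bij_betw_finite[OF bij] finite_standard by blast
  show "nonzero_monomials V J j \<subseteq> graded_component V J j"
  proof
    fix X assume "X \<in> nonzero_monomials V J j"
    then obtain m where m: "X = ?k m" "Poly_Mapping.keys m \<subseteq> V" "weight m = j"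
      by (auto simp: nonzero_monomials_def)
    have "homogeneous j (mon m :: ('v, 'k) mpoly)"
      using m by (simp add: homogeneous_def mon_def)
    then show "X \<in> graded_component V J j"
      unfolding graded_component_def using m(1) carrier_mon[OF m(2)] by blast
  qed
  have s_carrier: "?s c \<in> carrier R" for c
    by (rule poly_ring_sum_closed, rule carrier_single) (auto simp: standard_def)
  have s_lookup: "Poly_Mapping.lookup (?s c) m = (if m \<in> standard j then c (?k m) else 0)" for c m
    by (rule lookup_sum_single[OF finite_standard])
  have s_homogeneous: "homogeneous j (?s c)" for c
    unfolding homogeneous_def
  proof
    fix m assume "m \<in> Poly_Mapping.keys (?s c)"
    then have "m \<in> standard j"
      unfolding in_keys_iff s_lookup by (meson)
    then show "weight m = j" by (simp add: standard_def)
  qed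
  show "graded_component V J j = range (lin_comb Q (nonzero_monomials V J j))"
  proof (intro equalityI subsetI)
    fix X assume "X \<in> graded_component V J j"
    then obtain f where f: "X = coset f" "f \<in> carrier R" "homogeneous j f"
      by (auto simp: graded_component_def)
    \<comment> \<open>Coefficients must be a function of cosets; the inverse of \<open>bij\<close>
      returns the exponent of a basis coset.\<close>
    define c where "c X = Poly_Mapping.lookup f (inv_into (standard j) ?k X)" for X
    have c: "c (?k m) = Poly_Mapping.lookup f m" if "m \<in> standard j" for m
      using bij_betw_inv_into_left[OF bij that] by (simp add: c_def)
    \<comment> \<open>\<open>?s c\<close> is \<open>f\<close> without its terms in \<open>D\<close>,
      and those lie in \<open>J\<close>.\<close>
    have "coset (?s c) = coset f"
      unfolding coset_eq_iff[OF s_carrier f(2)] s_lookup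
      using f(3) c by (auto simp: standard_def homogeneous_def in_keys_iff)
    then show "X \<in> range (lin_comb Q (nonzero_monomials V J j))"
      using f(1) by (metis lin_comb_nonzero_monomials rangeI)
  next
    fix X assume "X \<in> range (lin_comb Q (nonzero_monomials V J j))"
    then show "X \<in> graded_component V J j"
      using s_carrier s_homogeneous
      unfolding graded_component_def lin_comb_nonzero_monomials by blast
  qed
  fix c assume "lin_comb Q (nonzero_monomials V J j) c = \<zero>\<^bsub>Q\<^esub>"
  then have "coset (?s c) = coset 0"
    by (simp add: lin_comb_nonzero_monomials Q_simps coset_zero)
  then have "c (?k m) = 0" if "m \<in> standard j" for m
    using that coset_eq_iff[OF s_carrier, of 0 c] s_lookup[of c m] by (auto simp: standard_def)
  then show "\<forall>b\<in>nonzero_monomials V J j. c b = 0"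
    unfolding bij_betw_imp_surj_on[OF bij, symmetric] by blast
qed

section \<open>Multiplication by the sum of the variables\<close>

lemma var_mult_mon:
  "var v * mon m = (mon (m + Poly_Mapping.single v 1) :: ('v, 'k) mpoly)"
  by (simp add: var_def mon_def mult_single add.commute)

text \<open>The products of one monomial with the different variables are pairwise distinct, so
  every coefficient is 0 or 1 and no multiplicities arise, whatever the characteristic. The
  hypothesis fixes \<open>A\<close> on basis cosets because a representing matrix is indexed by
  them.\<close>

lemma represents_linear_form:
  fixes A :: "('v, 'k) mpoly set \<Rightarrow> ('v, 'k) mpoly set \<Rightarrow> 'k"
  assumes A: "\<And>m m'. m \<in> standard j \<Longrightarrow> m' \<in> standard (j + 1) \<Longrightarrow>
      A (coset (mon m')) (coset (mon m)) =
        (if \<exists>v. m' = m + Poly_Mapping.single v 1 then 1 else 0)"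
  shows "represents Q
    (graded_component V J j) (nonzero_monomials V J j)
    (graded_component V J (j + 1)) (nonzero_monomials V J (j + 1))
    A (\<lambda>X. coset (\<Sum>v\<in>V. var v) \<otimes>\<^bsub>Q\<^esub> X)"
  unfolding represents_def
proof (intro conjI ballI finite_basis_nonzero_monomials)
  let ?L = "(\<Sum>v\<in>V. var v) :: ('v, 'k) mpoly"
  let ?k = "\<lambda>m. coset (mon m)"
  have L: "?L \<in> carrier R"
    by (rule poly_ring_sum_closed) (simp add: var_def mon_def)
  have L_homogeneous: "homogeneous (j + 1) (?L * f)" if "homogeneous j f" for f
    unfolding homogeneous_def
  proof
    fix m assume "m \<in> Poly_Mapping.keys (?L * f)"
    then obtain l m' where m: "m = l + m'" "l \<in> Poly_Mapping.keys ?L" "m' \<in> Poly_Mapping.keys f"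
      using keys_mult[of ?L f] by blast
    then obtain v where "l = Poly_Mapping.single v 1"
      using keys_sum[of "var :: 'v \<Rightarrow> ('v, 'k) mpoly" V] by (auto simp: var_def mon_def)
    with m that show "weight m = j + 1"
      by (simp add: homogeneous_def weight_add weight_single)
  qed
  show "linear_on Q (graded_component V J j) (graded_component V J (j + 1))
      (\<lambda>X. coset ?L \<otimes>\<^bsub>Q\<^esub> X)"
    unfolding linear_on_def
  proof (intro conjI ballI allI)
    have closed: "X \<in> carrier (R Quot J)" if "X \<in> graded_component V J j" for X
      using that coset_closed by (auto simp: graded_component_def simp del: poly_ring_simps)
    have const: "coset (const c) \<in> carrier (R Quot J)" for c
      by (rule coset_closed) (simp add: const_def)
    note L' = coset_closed[OF L]
    show "(\<lambda>X. coset ?L \<otimes>\<^bsub>Q\<^esub> X) \<in> graded_component V J j \<rightarrow> graded_component V J (j + 1)"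
    proof
      fix X assume "X \<in> graded_component V J j"
      then obtain f where f: "X = coset f" "f \<in> carrier R" "homogeneous j f"
        by (auto simp: graded_component_def)
      have "coset ?L \<otimes>\<^bsub>Q\<^esub> X = coset (?L * f)"
        unfolding f(1) Q_simps by (rule coset_mult[OF L f(2)])
      then show "coset ?L \<otimes>\<^bsub>Q\<^esub> X \<in> graded_component V J (j + 1)"
        unfolding graded_component_def
        using poly_ring_mult_closed[OF L f(2)] L_homogeneous[OF f(3)] by blast
    qed
    fix X assume X: "X \<in> graded_component V J j"
    show "coset ?L \<otimes>\<^bsub>Q\<^esub> (X \<oplus>\<^bsub>Q\<^esub> Y) = coset ?L \<otimes>\<^bsub>Q\<^esub> X \<oplus>\<^bsub>Q\<^esub> coset ?L \<otimes>\<^bsub>Q\<^esub> Y"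
      if "Y \<in> graded_component V J j" for Y
      using closed[OF X] closed[OF that] L' by (simp add: Q_simps quot.r_distr)
    show "coset ?L \<otimes>\<^bsub>Q\<^esub> (c \<odot>\<^bsub>Q\<^esub> X) = c \<odot>\<^bsub>Q\<^esub> (coset ?L \<otimes>\<^bsub>Q\<^esub> X)" for c
      using closed[OF X] const[of c] L' by (simp add: Q_simps quot.m_lcomm)
  qed
  fix x assume "x \<in> nonzero_monomials V J j"
  then obtain m where m: "m \<in> standard j" "x = ?k m"
    using bij_betw_standard[of j] by (auto simp: bij_betw_def)
  have mV: "Poly_Mapping.keys m \<subseteq> V" and mw: "weight m = j" using m by (auto simp: standard_def)
  let ?e = "\<lambda>v. m + Poly_Mapping.single v (1::nat)"
  let ?s = "(\<Sum>m'\<in>standard (j + 1). Poly_Mapping.single m' (A (?k m') x)) :: ('v, 'k) mpoly"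
  have s: "?s \<in> carrier R"
    by (rule poly_ring_sum_closed, rule carrier_single) (auto simp: standard_def)
  have Lm: "?L * mon m = (\<Sum>v\<in>V. mon (?e v))"
    by (simp add: sum_distrib_right var_mult_mon)
  have e_inj: "inj_on ?e V" by (auto simp: inj_on_def)
  have "coset (?L * mon m) = coset ?s"
    unfolding coset_eq_iff[OF poly_ring_mult_closed[OF L carrier_mon[OF mV]] s]
  proof (intro allI impI)
    fix m' assume m': "Poly_Mapping.keys m' \<subseteq> V" "m' \<notin> D"
    have "(\<Sum>v\<in>V. mon (?e v)) = (\<Sum>m'\<in>?e ` V. Poly_Mapping.single m' (1::'k))"
      unfolding sum.reindex[OF e_inj] by (simp add: mon_def)
    then have l: "Poly_Mapping.lookup (?L * mon m) m' = (if m' \<in> ?e ` V then 1 else 0)"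
      unfolding Lm using finite_V by (simp add: lookup_sum_single)
    \<comment> \<open>A variable \<open>v\<close> with \<open>m' = ?e v\<close> lies in
      \<open>V\<close> automatically, since \<open>m'\<close> is supported there.\<close>
    have "m' \<in> ?e ` V \<longleftrightarrow> weight m' = j + 1 \<and> (\<exists>v. m' = ?e v)"
      using m' mw by (auto simp: weight_add weight_single keys_add_nat)
    then show "Poly_Mapping.lookup (?L * mon m) m' = Poly_Mapping.lookup ?s m'"
      unfolding l lookup_sum_single[OF finite_standard]
      using m m' A[OF m(1), of m'] by (auto simp: standard_def)
  qed
  then show "coset ?L \<otimes>\<^bsub>Q\<^esub> x = lin_comb Q (nonzero_monomials V J (j + 1)) (\<lambda>y. A y x)"
    using coset_mult[OF L carrier_mon[OF mV]]
    by (simp add: lin_comb_nonzero_monomials Q_simps m(2))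
qed

end

section \<open>Stanley--Reisner, power and facet ideals as monomial spans\<close>

lemma var_power: "var v ^ k = (mon (Poly_Mapping.single v k) :: ('v, 'k::field) mpoly)"
  by (induction k) (simp_all add: mon_def var_def mult_single flip: single_add)

lemma prod_var: "(\<Prod>v\<in>F. var v) = (mon (face_exponent F) :: ('v, 'k::field) mpoly)"
  unfolding face_exponent_def
  by (induction F rule: infinite_finite_induct) (simp_all add: var_def mon_def mult_single)

lemma lookup_face_exponent:
  "finite F \<Longrightarrow> Poly_Mapping.lookup (face_exponent F) v = (if v \<in> F then 1 else 0)"
  unfolding face_exponent_def by (rule lookup_sum_single)

lemma keys_face_exponent: "finite F \<Longrightarrow> Poly_Mapping.keys (face_exponent F) = F"
  by (auto simp: in_keys_iff lookup_face_exponent split: if_splits)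

lemma add_minus_of_le:
  fixes m m' :: "'v \<Rightarrow>\<^sub>0 nat"
  assumes "\<And>v. Poly_Mapping.lookup m v \<le> Poly_Mapping.lookup m' v"
  shows "m' = m + (m' - m)"
  by (rule poly_mapping_eqI) (simp add: lookup_add lookup_minus assms)

lemma face_exponent_dvd_iff:
  assumes "finite F"
  shows "(\<exists>l. m = face_exponent F + l) \<longleftrightarrow> F \<subseteq> Poly_Mapping.keys m"
proof
  assume "F \<subseteq> Poly_Mapping.keys m"
  then have "m = face_exponent F + (m - face_exponent F)"
    by (intro add_minus_of_le) (auto simp: lookup_face_exponent assms in_keys_iff Suc_le_eq)
  then show "\<exists>l. m = face_exponent F + l" by blast
qed (auto simp: keys_add_nat keys_face_exponent assms)

lemma monomial_span_cong:
  "(\<And>m. Poly_Mapping.keys m \<subseteq> V \<Longrightarrow> m \<in> D \<longleftrightarrow> m \<in> E) \<Longrightarrow>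
    (monomial_span V D :: ('v, 'k::field) mpoly set) = monomial_span V E"
  unfolding monomial_span_def poly_ring_simps by blast

text \<open>Because \<open>\<Delta>\<close> is closed under subsets, a support inside
  \<open>V\<close> contains a nonface exactly when it is itself a nonface.\<close>

lemma stanley_reisner_ideal_eq:
  assumes "simplicial_complex V \<Delta>"
  shows "(stanley_reisner_ideal V \<Delta> :: ('v, 'k::field) mpoly set) =
    monomial_span V {m. Poly_Mapping.keys m \<notin> \<Delta>}"
proof -
  let ?S = "{\<sigma>. \<sigma> \<subseteq> V \<and> \<sigma> \<notin> \<Delta>}"
  have V: "finite V" and down: "\<And>F G. F \<in> \<Delta> \<Longrightarrow> G \<subseteq> F \<Longrightarrow> G \<in> \<Delta>"
    using assms by (auto simp: simplicial_complex_def)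
  have fin: "finite \<sigma>" if "\<sigma> \<in> ?S" for \<sigma>
    using that V finite_subset by blast
  have "{\<Prod>v\<in>\<sigma>. var v |\<sigma>. \<sigma> \<subseteq> V \<and> \<sigma> \<notin> \<Delta>} =
      (mon ` face_exponent ` ?S :: ('v, 'k) mpoly set)"
    by (auto simp: prod_var)
  then have "(stanley_reisner_ideal V \<Delta> :: ('v, 'k) mpoly set) =
      Idl\<^bsub>poly_ring V\<^esub> (mon ` face_exponent ` ?S)"
    by (simp add: stanley_reisner_ideal_def)
  also have "\<dots> = monomial_span V {m. \<exists>g\<in>face_exponent ` ?S. \<exists>l. m = g + l}"
  proof (rule genideal_monomials)
    fix m assume "m \<in> face_exponent ` ?S"
    then obtain \<sigma> where \<sigma>: "\<sigma> \<in> ?S" "m = face_exponent \<sigma>" by blast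
    then show "Poly_Mapping.keys m \<subseteq> V" using keys_face_exponent[OF fin[OF \<sigma>(1)]] by simp
  qed
  also have "\<dots> = monomial_span V {m. Poly_Mapping.keys m \<notin> \<Delta>}"
  proof (rule monomial_span_cong)
    fix m :: "'v \<Rightarrow>\<^sub>0 nat" assume m: "Poly_Mapping.keys m \<subseteq> V"
    have "m \<in> {m. \<exists>g\<in>face_exponent ` ?S. \<exists>l. m = g + l} \<longleftrightarrow>
        (\<exists>\<sigma>\<in>?S. \<exists>l. m = face_exponent \<sigma> + l)" by simp
    also have "\<dots> \<longleftrightarrow> (\<exists>\<sigma>\<in>?S. \<sigma> \<subseteq> Poly_Mapping.keys m)"
      by (intro bex_cong refl face_exponent_dvd_iff fin)
    also have "\<dots> \<longleftrightarrow> Poly_Mapping.keys m \<notin> \<Delta>"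
      using m down by blast
    finally show "m \<in> {m. \<exists>g\<in>face_exponent ` ?S. \<exists>l. m = g + l} \<longleftrightarrow>
        m \<in> {m. Poly_Mapping.keys m \<notin> \<Delta>}" by simp
  qed
  finally show ?thesis .
qed

lemma pure_power_ideal_eq:
  "(pure_power_ideal V a :: ('v, 'k::field) mpoly set) =
    monomial_span V {m. \<exists>v\<in>V. a \<le> Poly_Mapping.lookup m v}"
proof -
  let ?G = "(\<lambda>v. Poly_Mapping.single v a) ` V"
  have "{var v ^ a |v. v \<in> V} = (mon ` ?G :: ('v, 'k) mpoly set)"
    by (auto simp: var_power)
  then have "(pure_power_ideal V a :: ('v, 'k) mpoly set) = Idl\<^bsub>poly_ring V\<^esub> (mon ` ?G)"
    by (simp add: pure_power_ideal_def)
  also have "\<dots> = monomial_span V {m. \<exists>g\<in>?G. \<exists>l. m = g + l}"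
    by (rule genideal_monomials) (auto split: if_splits)
  also have "\<dots> = monomial_span V {m. \<exists>v\<in>V. a \<le> Poly_Mapping.lookup m v}"
  proof (rule monomial_span_cong)
    fix m :: "'v \<Rightarrow>\<^sub>0 nat"
    have "(\<exists>l. m = Poly_Mapping.single v a + l) \<longleftrightarrow> a \<le> Poly_Mapping.lookup m v" for v
    proof
      assume "a \<le> Poly_Mapping.lookup m v"
      then have "m = Poly_Mapping.single v a + (m - Poly_Mapping.single v a)"
        by (intro add_minus_of_le) (auto simp: lookup_single when_def)
      then show "\<exists>l. m = Poly_Mapping.single v a + l" by blast
    qed (auto simp: lookup_add)
    moreover have "m \<in> {m. \<exists>g\<in>?G. \<exists>l. m = g + l} \<longleftrightarrow> (\<exists>v\<in>V. \<exists>l. m = Poly_Mapping.single v a + l)"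
      by simp
    ultimately show "m \<in> {m. \<exists>g\<in>?G. \<exists>l. m = g + l} \<longleftrightarrow>
        m \<in> {m. \<exists>v\<in>V. a \<le> Poly_Mapping.lookup m v}" by simp
  qed
  finally show ?thesis .
qed

lemma facet_ideal_eq:
  assumes fin: "\<And>F. F \<in> facets \<Gamma> \<Longrightarrow> finite F"
  shows "(facet_ideal \<Gamma> :: ('v, 'k::field) mpoly set) =
    monomial_span (vertices \<Gamma>) {m. \<exists>F\<in>facets \<Gamma>. F \<subseteq> Poly_Mapping.keys m}"
proof -
  have "{\<Prod>v\<in>F. var v |F. F \<in> facets \<Gamma>} = (mon ` face_exponent ` facets \<Gamma> :: ('v, 'k) mpoly set)"
    by (auto simp: prod_var)
  then have "(facet_ideal \<Gamma> :: ('v, 'k) mpoly set) =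
      Idl\<^bsub>poly_ring (vertices \<Gamma>)\<^esub> (mon ` face_exponent ` facets \<Gamma>)"
    by (simp add: facet_ideal_def)
  also have "\<dots> = monomial_span (vertices \<Gamma>) {m. \<exists>g\<in>face_exponent ` facets \<Gamma>. \<exists>l. m = g + l}"
  proof (rule genideal_monomials)
    fix m assume "m \<in> face_exponent ` facets \<Gamma>"
    then obtain F where F: "F \<in> facets \<Gamma>" "m = face_exponent F" by blast
    then show "Poly_Mapping.keys m \<subseteq> vertices \<Gamma>"
      using keys_face_exponent[OF fin[OF F(1)]] by (auto simp: facets_def vertices_def)
  qed
  also have "{m. \<exists>g\<in>face_exponent ` facets \<Gamma>. \<exists>l. m = g + l} =
      {m. \<exists>F\<in>facets \<Gamma>. \<exists>l. m = face_exponent F + l}" by simp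
  also have "\<dots> = {m. \<exists>F\<in>facets \<Gamma>. F \<subseteq> Poly_Mapping.keys m}"
    by (intro Collect_cong bex_cong refl face_exponent_dvd_iff fin)
  finally show ?thesis .
qed

section \<open>Minimal generators and log matrix of a facet ideal\<close>

lemma mon_mem_monomial_span:
  "mon m \<in> (monomial_span V D :: ('v, 'k::field) mpoly set) \<longleftrightarrow> Poly_Mapping.keys m \<subseteq> V \<and> m \<in> D"
  by (simp add: monomial_span_def mon_def)

text \<open>Facets form an antichain: a monomial of the ideal that divides x_F has a facet G inside
  its support, G is contained in F, and so G = F. Thus none of the generators is redundant.\<close>

lemma bij_betw_face_exponent:
  assumes fin: "\<And>F. F \<in> facets \<Gamma> \<Longrightarrow> finite F"
  shows "bij_betw face_exponent (facets \<Gamma>)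
    (minimal_generators (facet_ideal \<Gamma> :: ('v, 'k::field) mpoly set))"
proof (rule bij_betw_imageI)
  show "inj_on face_exponent (facets \<Gamma>)"
    by (rule inj_onI) (metis fin keys_face_exponent)
  let ?I = "facet_ideal \<Gamma> :: ('v, 'k) mpoly set"
  have mem: "mon m \<in> ?I \<longleftrightarrow> Poly_Mapping.keys m \<subseteq> vertices \<Gamma> \<and>
      (\<exists>F\<in>facets \<Gamma>. F \<subseteq> Poly_Mapping.keys m)" for m
    by (simp add: facet_ideal_eq[OF fin] mon_mem_monomial_span)
  have gen: "mon (face_exponent F) \<in> ?I" if "F \<in> facets \<Gamma>" for F
    using that by (auto simp: mem keys_face_exponent fin facets_def vertices_def)
  show "face_exponent ` facets \<Gamma> = minimal_generators ?I"
  proof (intro equalityI subsetI)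
    fix m assume "m \<in> face_exponent ` facets \<Gamma>"
    then obtain F where F: "F \<in> facets \<Gamma>" "m = face_exponent F" by blast
    have "m' = m" if m': "mon m' \<in> ?I"
      and le: "\<forall>v. Poly_Mapping.lookup m' v \<le> Poly_Mapping.lookup m v" for m'
    proof -
      obtain G where G: "G \<in> facets \<Gamma>" "G \<subseteq> Poly_Mapping.keys m'"
        using m' by (auto simp: mem)
      have "Poly_Mapping.lookup m' v = 0" if "v \<notin> F" for v
        using le[rule_format, of v] that F fin by (simp add: lookup_face_exponent)
      then have "Poly_Mapping.keys m' \<subseteq> F" by (auto simp: in_keys_iff)
      moreover from this G have "G = F" using F(1) by (auto simp: facets_def)
      ultimately have keys: "Poly_Mapping.keys m' = F" using G(2) by blast
      show "m' = m"
      proof (rule poly_mapping_eqI)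
        fix v
        show "Poly_Mapping.lookup m' v = Poly_Mapping.lookup m v"
          using le[rule_format, of v] keys F fin[OF F(1)]
          by (cases "v \<in> F") (auto simp: lookup_face_exponent in_keys_iff)
      qed
    qed
    then show "m \<in> minimal_generators ?I"
      using gen F by (simp add: minimal_generators_def)
  next
    fix m assume m: "m \<in> minimal_generators ?I"
    then obtain F where F: "F \<in> facets \<Gamma>" "F \<subseteq> Poly_Mapping.keys m"
      by (auto simp: minimal_generators_def mem)
    then have "Poly_Mapping.lookup (face_exponent F) v \<le> Poly_Mapping.lookup m v" for v
      using fin[OF F(1)] by (auto simp: lookup_face_exponent in_keys_iff Suc_le_eq)
    then have "face_exponent F = m"
      using m gen[OF F(1)] by (auto simp: minimal_generators_def)
    then show "m \<in> face_exponent ` facets \<Gamma>" using F(1) by blast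
  qed
qed

lemma log_matrix_face_exponent:
  assumes fin: "\<And>F. F \<in> facets \<Gamma> \<Longrightarrow> finite F" and "F \<in> facets \<Gamma>"
  shows "log_matrix (facet_ideal \<Gamma> :: ('v, 'k::field) mpoly set) (face_exponent F) v =
    (if v \<in> F then 1 else 0)"
proof -
  \<comment> \<open>\<open>log_matrix\<close> is \<open>undefined\<close> outside the minimal
    generators, so membership must precede its evaluation.\<close>
  have "face_exponent F \<in> minimal_generators (facet_ideal \<Gamma> :: ('v, 'k) mpoly set)"
    using bij_betw_apply[OF bij_betw_face_exponent[OF fin]] assms(2) by blast
  then show ?thesis
    using assms by (simp add: log_matrix_def lookup_face_exponent)
qed

section \<open>Incidence complexes and half-hollow edgewise subdivisions\<close>

lemma facets_generated_complex:
  assumes "\<And>F G. F \<in> S \<Longrightarrow> G \<in> S \<Longrightarrow> F \<subseteq> G \<Longrightarrow> F = G"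
  shows "facets (generated_complex S) = S"
proof (intro equalityI subsetI)
  fix F assume F: "F \<in> facets (generated_complex S)"
  then obtain G where G: "G \<in> S" "F \<subseteq> G" by (auto simp: facets_def generated_complex_def)
  then have "G \<in> generated_complex S" by (auto simp: generated_complex_def)
  then show "F \<in> S" using F G by (auto simp: facets_def)
next
  fix F assume F: "F \<in> S"
  have "F = G" if G: "G \<in> generated_complex S" "F \<subseteq> G" for G
  proof -
    obtain H where H: "H \<in> S" "G \<subseteq> H" using G(1) by (auto simp: generated_complex_def)
    then have "F = H" using F G(2) by (intro assms) auto
    then show ?thesis using G(2) H(2) by blast
  qed
  moreover have "F \<in> generated_complex S" using F by (auto simp: generated_complex_def)
  ultimately show "F \<in> facets (generated_complex S)" by (auto simp: facets_def)
qed

lemma vertices_generated_complex: "vertices (generated_complex S) = \<Union>S"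
  by (auto simp: vertices_def generated_complex_def)

section \<open>Ridges of a face\<close>

definition ridges :: "'v set \<Rightarrow> 'v set set" where
  "ridges F = (\<lambda>v. F - {v}) ` F"

lemma inj_on_ridge: "inj_on (\<lambda>v. F - {v}) F"
  by (rule inj_onI) blast

lemma finite_ridges: "finite F \<Longrightarrow> finite (ridges F)"
  by (simp add: ridges_def)

text \<open>Links two descriptions: the incidence complex selects faces by dimension, whereas sums
  and exponents are indexed by the omitted vertex.\<close>

lemma ridges_eq:
  assumes "card F = d + 1"
  shows "ridges F = {E. E \<subseteq> F \<and> card E = d}"
proof (intro equalityI subsetI)
  have fin: "finite F" using assms by (simp add: card_ge_0_finite)
  fix E assume "E \<in> ridges F"
  then show "E \<in> {E. E \<subseteq> F \<and> card E = d}" using assms fin by (auto simp: ridges_def)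
next
  have fin: "finite F" using assms by (simp add: card_ge_0_finite)
  fix E assume E: "E \<in> {E. E \<subseteq> F \<and> card E = d}"
  then have "finite E" using fin finite_subset by auto
  then have "card (F - E) = 1" using assms E by (simp add: card_Diff_subset)
  then obtain v where "F - E = {v}" by (rule card_1_singletonE)
  then have "E = F - {v}" "v \<in> F" using E by auto
  then show "E \<in> ridges F" by (auto simp: ridges_def)
qed

text \<open>A face with a single vertex has only the empty ridge, so two vertices are required. For
  \<open>d\<close>-faces this is where \<open>d \<ge> 1\<close> enters.\<close>

lemma Union_ridges:
  assumes "card F \<ge> 2"
  shows "\<Union>(ridges F) = F"
proof (intro equalityI subsetI)
  fix v assume v: "v \<in> F"
  have "F \<noteq> {v}" using assms by auto
  then obtain w where "w \<in> F" "w \<noteq> v" using v by blast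
  then show "v \<in> \<Union>(ridges F)" using v by (auto simp: ridges_def)
qed (auto simp: ridges_def)

section \<open>Vectors on ridges and their monomials\<close>

definition simplex :: "'v set \<Rightarrow> ('v set \<Rightarrow>\<^sub>0 nat) \<Rightarrow> ('v set \<Rightarrow>\<^sub>0 nat) set" where
  "simplex F b = (\<lambda>v. b + Poly_Mapping.single (F - {v}) 1) ` F"

lemma card_simplex: "card (simplex F b) = card F"
  unfolding simplex_def by (rule card_image) (auto simp: inj_on_def)

text \<open>A vector \<open>b\<close> of \<open>hesd (incidence_complex \<Delta> d) r\<close> assigns a multiplicity to each
  \<open>(d-1)\<close>-face; the corresponding monomial is the product of these faces, each regarded as a
  squarefree monomial.\<close>

definition face_product :: "('v set \<Rightarrow>\<^sub>0 nat) \<Rightarrow> ('v \<Rightarrow>\<^sub>0 nat)" where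
  "face_product b =
    (\<Sum>E\<in>Poly_Mapping.keys b. \<Sum>v\<in>E. Poly_Mapping.single v (Poly_Mapping.lookup b E))"

lemma sum_ridges: "(\<Sum>E\<in>ridges F. f E) = (\<Sum>v\<in>F. f (F - {v}))"
  unfolding ridges_def by (simp add: sum.reindex[OF inj_on_ridge])

lemma weight_ridges:
  assumes "finite F" "Poly_Mapping.keys b \<subseteq> ridges F"
  shows "weight b = (\<Sum>v\<in>F. Poly_Mapping.lookup b (F - {v}))"
  using weight_superset[OF finite_ridges[OF assms(1)] assms(2)] by (simp add: sum_ridges)

text \<open>A vertex of \<open>F\<close> lies in every ridge of \<open>F\<close> except the opposite
  one, so its exponent collects all the weight of \<open>b\<close> but the part on that
  ridge.\<close>

lemma lookup_face_product:
  assumes "finite F" "Poly_Mapping.keys b \<subseteq> ridges F"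
  shows "Poly_Mapping.lookup (face_product b) v =
    (if v \<in> F then weight b - Poly_Mapping.lookup b (F - {v}) else 0)"
proof -
  have finE: "finite E" if "E \<in> ridges F" for E
    using that assms(1) by (auto simp: ridges_def)
  have "Poly_Mapping.lookup (face_product b) v =
      (\<Sum>E\<in>Poly_Mapping.keys b. if v \<in> E then Poly_Mapping.lookup b E else 0)"
    unfolding face_product_def lookup_sum[of _ "Poly_Mapping.keys b"]
  proof (rule sum.cong[OF refl])
    fix E assume "E \<in> Poly_Mapping.keys b"
    then have "finite E" using assms(2) finE by blast
    then show "Poly_Mapping.lookup (\<Sum>v\<in>E. Poly_Mapping.single v (Poly_Mapping.lookup b E)) v =
        (if v \<in> E then Poly_Mapping.lookup b E else 0)"
      by (rule lookup_sum_single)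
  qed
  also have "\<dots> = (\<Sum>E\<in>ridges F. if v \<in> E then Poly_Mapping.lookup b E else 0)"
    by (rule sum.mono_neutral_left)
      (use assms finite_ridges in \<open>auto simp: in_keys_iff\<close>)
  also have "\<dots> = (\<Sum>w\<in>F. if v \<in> F - {w} then Poly_Mapping.lookup b (F - {w}) else 0)"
    by (rule sum_ridges)
  finally have eq: "Poly_Mapping.lookup (face_product b) v =
      (\<Sum>w\<in>F. if v \<in> F - {w} then Poly_Mapping.lookup b (F - {w}) else 0)" .
  show ?thesis
  proof (cases "v \<in> F")
    case True
    have "weight b = Poly_Mapping.lookup b (F - {v}) +
        (\<Sum>w\<in>F - {v}. Poly_Mapping.lookup b (F - {w}))"
      unfolding weight_ridges[OF assms] by (rule sum.remove[OF assms(1) True])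
    moreover have "(\<Sum>w\<in>F. if v \<in> F - {w} then Poly_Mapping.lookup b (F - {w}) else 0) =
        (\<Sum>w\<in>F - {v}. Poly_Mapping.lookup b (F - {w}))"
      by (rule sum.mono_neutral_cong_right) (use True assms(1) in auto)
    ultimately show ?thesis using True eq by simp
  next
    case False
    then show ?thesis using eq by simp
  qed
qed

lemma lookup_face_product_add:
  assumes "finite F" "Poly_Mapping.keys b \<subseteq> ridges F" "v \<in> F"
  shows "Poly_Mapping.lookup (face_product b) v + Poly_Mapping.lookup b (F - {v}) = weight b"
  using assms lookup_le_weight[of b "F - {v}"] by (simp add: lookup_face_product)

lemma keys_face_product:
  assumes "finite F" "Poly_Mapping.keys b \<subseteq> ridges F"
  shows "Poly_Mapping.keys (face_product b) \<subseteq> F"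
  using assms by (auto simp: in_keys_iff lookup_face_product split: if_splits)

text \<open>Summing \<open>lookup_face_product_add\<close> over the \<open>d + 1\<close> vertices
  gives \<open>d + 1\<close> times the weight of \<open>b\<close>, and the values of
  \<open>b\<close> on the ridges account for one copy of it.\<close>

lemma weight_face_product:
  assumes "card F = d + 1" "Poly_Mapping.keys b \<subseteq> ridges F"
  shows "weight (face_product b) = d * weight b"
proof -
  have fin: "finite F" using assms(1) by (simp add: card_ge_0_finite)
  have "weight (face_product b) + weight b =
      (\<Sum>v\<in>F. Poly_Mapping.lookup (face_product b) v + Poly_Mapping.lookup b (F - {v}))"
    unfolding sum.distrib weight_ridges[OF fin assms(2)]
    by (simp add: weight_superset[OF fin keys_face_product[OF fin assms(2)]])
  also have "\<dots> = (d + 1) * weight b"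
    using lookup_face_product_add[OF fin assms(2)] assms(1) by simp
  finally show ?thesis by simp
qed

text \<open>Places \<open>c v\<close> on the ridge opposite to \<open>v\<close>. With
  \<open>c\<close> the complementary exponents it inverts \<open>face_product\<close> on a fixed
  face.\<close>

definition ridge_vector :: "'v set \<Rightarrow> ('v \<Rightarrow> nat) \<Rightarrow> ('v set \<Rightarrow>\<^sub>0 nat)" where
  "ridge_vector F c = (\<Sum>v\<in>F. Poly_Mapping.single (F - {v}) (c v))"

lemma lookup_ridge_vector:
  assumes "finite F" "v \<in> F"
  shows "Poly_Mapping.lookup (ridge_vector F c) (F - {v}) = c v"
proof -
  have "(\<Sum>w\<in>F. Poly_Mapping.lookup (Poly_Mapping.single (F - {w}) (c w)) (F - {v})) =
      (\<Sum>w\<in>F. if w = v then c w else 0)"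
    using assms(2) by (intro sum.cong) (auto simp: lookup_single when_def)
  then show ?thesis using assms by (simp add: ridge_vector_def lookup_sum)
qed

lemma keys_ridge_vector:
  "finite F \<Longrightarrow> Poly_Mapping.keys (ridge_vector F c) \<subseteq> ridges F"
  unfolding ridge_vector_def by (auto simp: keys_sum_nat ridges_def split: if_splits)

lemma weight_ridge_vector: "weight (ridge_vector F c) = (\<Sum>v\<in>F. c v)"
  by (simp add: ridge_vector_def weight_sum weight_single)

text \<open>Purely combinatorial, without field or ideals. The number \<open>r\<close> stands for
  \<open>a - 1\<close>, the largest exponent of a variable that survives in the quotient.\<close>

locale pure_complex =
  fixes V :: "'v set" and \<Delta> :: "'v set set" and d r :: nat
  assumes complex: "simplicial_complex V \<Delta>"
    and pure: "pure \<Delta>"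
    and dim: "complex_dim \<Delta> = int d"
    and d_pos: "d \<ge> 1"
    and r_pos: "r \<ge> 1"
begin

abbreviation H :: "('v set \<Rightarrow>\<^sub>0 nat) set set" where
  "H \<equiv> hesd (incidence_complex \<Delta> d) r"

definition top_faces :: "'v set set" where
  "top_faces = {F \<in> \<Delta>. card F = d + 1}"

definition monomials :: "nat \<Rightarrow> ('v \<Rightarrow>\<^sub>0 nat) set" where
  "monomials j = {m. Poly_Mapping.keys m \<in> \<Delta> \<and> (\<forall>v. Poly_Mapping.lookup m v \<le> r) \<and> weight m = j}"

lemma face_closed: "F \<in> \<Delta> \<Longrightarrow> G \<subseteq> F \<Longrightarrow> G \<in> \<Delta>"
  using complex by (auto simp: simplicial_complex_def)

lemma finite_faces: "finite \<Delta>"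
  using complex finite_subset by (auto simp: simplicial_complex_def)

lemma finite_face: "F \<in> \<Delta> \<Longrightarrow> finite F"
  using complex finite_subset by (auto simp: simplicial_complex_def)

lemma card_face_le: "F \<in> \<Delta> \<Longrightarrow> card F \<le> d + 1"
proof -
  assume "F \<in> \<Delta>"
  then have "face_dim F \<le> Max (face_dim ` \<Delta>)" using finite_faces by simp
  then show ?thesis using dim by (simp add: complex_dim_def face_dim_def)
qed

lemma top_faceD:
  assumes "F \<in> top_faces"
  shows "F \<in> \<Delta>" "card F = d + 1" "finite F" "card F \<ge> 2"
  using assms d_pos finite_face by (auto simp: top_faces_def)

text \<open>Every face lies in a facet, and purity gives all facets one dimension. Since purity only
  compares facets with each other, a face attaining the maximum is needed to identify that dimension
  as \<open>d\<close>.\<close>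

lemma face_in_top_face:
  assumes "E \<in> \<Delta>"
  obtains F where "F \<in> top_faces" "E \<subseteq> F"
proof -
  have "\<Delta> \<noteq> {}" using assms by blast
  then have "Max (face_dim ` \<Delta>) \<in> face_dim ` \<Delta>" using finite_faces by (intro Max_in) auto
  then obtain F0 where F0: "F0 \<in> \<Delta>" "card F0 = d + 1"
    using dim by (auto simp: complex_dim_def face_dim_def)
  have facet0: "F0 \<in> facets \<Delta>"
    unfolding facets_def
  proof (intro CollectI conjI ballI impI F0)
    fix G assume G: "G \<in> \<Delta>" "F0 \<subseteq> G"
    then show "F0 = G"
      using card_face_le[OF G(1)] F0(2) finite_face[OF G(1)] by (intro card_seteq) auto
  qed
  obtain F where F: "F \<in> \<Delta>" "E \<subseteq> F" "\<forall>G\<in>\<Delta>. F \<subseteq> G \<longrightarrow> F = G"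
    using finite_has_maximal2[OF finite_faces assms] by blast
  from F have "F \<in> facets \<Delta>" by (simp add: facets_def)
  then have "face_dim F = face_dim F0" using pure facet0 unfolding pure_def by blast
  then have "F \<in> top_faces" using F(1) F0(2) by (simp add: top_faces_def face_dim_def)
  then show thesis using F(2) that by blast
qed

section \<open>Facets and vertices of the subdivision\<close>

lemma facets_incidence_complex: "facets (incidence_complex \<Delta> d) = ridges ` top_faces"
proof -
  have "{E \<in> \<Delta>. E \<subseteq> F \<and> face_dim E = int d - 1} = ridges F" if "F \<in> top_faces" for F
    unfolding ridges_eq[OF top_faceD(2)[OF that]]
    using face_closed[OF top_faceD(1)[OF that]] by (auto simp: face_dim_def)
  moreover have "F \<in> \<Delta> \<and> face_dim F = int d \<longleftrightarrow> F \<in> top_faces" for F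
    by (auto simp: top_faces_def face_dim_def)
  ultimately have "{{E \<in> \<Delta>. E \<subseteq> F \<and> face_dim E = int d - 1} |F. F \<in> \<Delta> \<and> face_dim F = int d} =
      ridges ` top_faces"
    unfolding image_def by (intro Collect_cong) (metis (no_types, lifting))
  then have "incidence_complex \<Delta> d = generated_complex (ridges ` top_faces)"
    by (simp add: incidence_complex_def)
  \<comment> \<open>A top face is the union of its ridges, and top faces have equal cardinality, so
    an inclusion of ridge sets forces equality.\<close>
  moreover have "ridges F = ridges G"
    if F: "F \<in> top_faces" and G: "G \<in> top_faces" and sub: "ridges F \<subseteq> ridges G" for F G
  proof -
    have "F \<subseteq> G"
      using Union_mono[OF sub] by (simp add: Union_ridges top_faceD(4)[OF F] top_faceD(4)[OF G])
    then have "F = G" using top_faceD[OF F] top_faceD[OF G] by (intro card_subset_eq) auto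
    then show ?thesis by simp
  qed
  ultimately show ?thesis by (auto intro!: facets_generated_complex)
qed

lemma hesd_eq:
  "H = generated_complex
    {simplex F b |F b. F \<in> top_faces \<and> Poly_Mapping.keys b \<subseteq> ridges F \<and> weight b + 1 = r}"
proof -
  have img: "(\<lambda>E. b + Poly_Mapping.single E 1) ` ridges F = simplex F b" for F :: "'v set" and b
    by (auto simp: ridges_def simplex_def)
  have "{(\<lambda>E. b + Poly_Mapping.single E 1) ` B |B b.
        B \<in> ridges ` top_faces \<and> Poly_Mapping.keys b \<subseteq> B \<and> weight b + 1 = r} =
      {simplex F b |F b. F \<in> top_faces \<and> Poly_Mapping.keys b \<subseteq> ridges F \<and> weight b + 1 = r}"
    (is "?A = ?B")
  proof (intro equalityI subsetI)
    fix X assume "X \<in> ?A"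
    then obtain F b where "X = simplex F b" "F \<in> top_faces" "Poly_Mapping.keys b \<subseteq> ridges F"
      "weight b + 1 = r" using img by (elim CollectE exE conjE imageE) simp
    then show "X \<in> ?B" by (intro CollectI exI conjI)
  next
    fix X assume "X \<in> ?B"
    then obtain F b where "X = simplex F b" "F \<in> top_faces" "Poly_Mapping.keys b \<subseteq> ridges F"
      "weight b + 1 = r" by (elim CollectE exE conjE)
    then show "X \<in> ?A" by (intro CollectI exI[of _ "ridges F"] exI[of _ b])
      (simp add: img[unfolded One_nat_def])
  qed
  then show ?thesis
    by (simp only: hesd_def facets_incidence_complex)
qed

text \<open>All generating simplices have \<open>d + 1\<close> elements, so none is properly
  contained in another.\<close>

lemma facets_hesd:
  "facets H = {simplex F b |F b. F \<in> top_faces \<and> Poly_Mapping.keys b \<subseteq> ridges F \<and> weight b + 1 = r}"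
  unfolding hesd_eq
proof (rule facets_generated_complex)
  let ?S = "{simplex F b |F b. F \<in> top_faces \<and> Poly_Mapping.keys b \<subseteq> ridges F \<and> weight b + 1 = r}"
  fix X Y assume X: "X \<in> ?S" and Y: "Y \<in> ?S" and "X \<subseteq> Y"
  from X Y have "card X = d + 1" "card Y = d + 1" by (auto simp: card_simplex top_faceD)
  then show "X = Y" using \<open>X \<subseteq> Y\<close>
    by (intro card_subset_eq card_ge_0_finite) auto
qed

lemma finite_facet_hesd: "X \<in> facets H \<Longrightarrow> finite X"
  by (auto simp: facets_hesd simplex_def top_faceD)

lemma vertices_hesd:
  "vertices H = {b. weight b = r \<and> (\<exists>F\<in>top_faces. Poly_Mapping.keys b \<subseteq> ridges F)}"
proof (intro equalityI subsetI)
  fix b assume "b \<in> vertices H"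
  then obtain F c v where *: "F \<in> top_faces" "Poly_Mapping.keys c \<subseteq> ridges F" "weight c + 1 = r"
      "v \<in> F" "b = c + Poly_Mapping.single (F - {v}) 1"
    unfolding hesd_eq vertices_generated_complex by (auto simp: simplex_def)
  then have "Poly_Mapping.keys b \<subseteq> ridges F" by (auto simp: keys_add_nat ridges_def)
  moreover have "weight b = r" using * by (simp add: weight_add weight_single)
  ultimately show "b \<in> {b. weight b = r \<and> (\<exists>F\<in>top_faces. Poly_Mapping.keys b \<subseteq> ridges F)}"
    using *(1) by blast
next
  fix b :: "'v set \<Rightarrow>\<^sub>0 nat"
  assume "b \<in> {b. weight b = r \<and> (\<exists>F\<in>top_faces. Poly_Mapping.keys b \<subseteq> ridges F)}"
  then obtain F where b: "weight b = r" "F \<in> top_faces" "Poly_Mapping.keys b \<subseteq> ridges F"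
    by blast
  \<comment> \<open>Positive weight provides a ridge from which one unit can be removed, which
    exhibits \<open>b\<close> as a vertex of a simplex.\<close>
  have "Poly_Mapping.keys b \<noteq> {}" using b(1) r_pos by (auto simp: weight_def)
  then obtain E where E: "E \<in> Poly_Mapping.keys b" by blast
  then obtain v where "v \<in> F" "E = F - {v}" using b(3) by (auto simp: ridges_def)
  with E have v: "v \<in> F" "F - {v} \<in> Poly_Mapping.keys b" by simp_all
  define c where "c = b - Poly_Mapping.single (F - {v}) 1"
  have bc: "b = c + Poly_Mapping.single (F - {v}) 1"
    unfolding c_def add.commute[of _ "Poly_Mapping.single (F - {v}) 1"]
    by (rule add_minus_of_le) (use v in \<open>auto simp: lookup_single when_def in_keys_iff\<close>)
  have "Poly_Mapping.keys c \<subseteq> ridges F" using b(3) by (auto simp: bc keys_add_nat)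
  moreover have "weight c + 1 = r" using b(1) by (simp add: bc weight_add weight_single)
  moreover have "b \<in> simplex F c" using v(1) bc by (auto simp: simplex_def)
  ultimately show "b \<in> vertices H"
    unfolding hesd_eq vertices_generated_complex using b(2) by blast
qed

text \<open>If \<open>F\<close> is not determined by the monomial of \<open>b\<close>, then all the weight of \<open>b\<close> sits on one
  ridge, which the monomial determines.\<close>

lemma vector_of_degenerate:
  assumes b: "weight b = r" and F: "finite F" "Poly_Mapping.keys b \<subseteq> ridges F"
    and v: "v \<in> F" "v \<notin> Poly_Mapping.keys (face_product b)"
  shows "b = Poly_Mapping.single (Poly_Mapping.keys (face_product b)) r"
proof -
  have bv: "Poly_Mapping.lookup b (F - {v}) = r"
    using lookup_face_product_add[OF F v(1)] v(2) b by (simp add: in_keys_iff)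
  have sum: "weight b = Poly_Mapping.lookup b (F - {v}) +
      (\<Sum>w\<in>F - {v}. Poly_Mapping.lookup b (F - {w}))"
    unfolding weight_ridges[OF F] by (rule sum.remove[OF F(1) v(1)])
  then have "(\<Sum>w\<in>F - {v}. Poly_Mapping.lookup b (F - {w})) = 0"
    using b bv by simp
  then have zero: "Poly_Mapping.lookup b (F - {w}) = 0" if "w \<in> F" "w \<noteq> v" for w
    using that F(1) by simp
  \<comment> \<open>The remaining vertices have exponent \<open>r \<ge> 1\<close>, so the ridge is
    the support and can be named without mentioning \<open>F\<close>.\<close>
  have keys: "Poly_Mapping.keys (face_product b) = F - {v}"
  proof (rule Set.set_eqI)
    fix w
    show "w \<in> Poly_Mapping.keys (face_product b) \<longleftrightarrow> w \<in> F - {v}"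
      using b r_pos zero[of w] bv by (cases "w = v") (auto simp: in_keys_iff lookup_face_product[OF F])
  qed
  show ?thesis
    unfolding keys
  proof (rule poly_mapping_eqI)
    fix E
    show "Poly_Mapping.lookup b E = Poly_Mapping.lookup (Poly_Mapping.single (F - {v}) r) E"
    proof (cases "E \<in> ridges F")
      case True
      then show ?thesis using bv zero v(1) by (auto simp: ridges_def lookup_single when_def)
    next
      case False
      then have "E \<notin> Poly_Mapping.keys b" "E \<noteq> F - {v}" using F(2) v(1) by (auto simp: ridges_def)
      then show ?thesis by (simp add: in_keys_iff lookup_single when_def)
    qed
  qed
qed

lemma inj_on_face_product: "inj_on face_product (vertices H)"
proof (rule inj_onI)
  fix b b' assume b: "b \<in> vertices H" and b': "b' \<in> vertices H"
    and eq: "face_product b = face_product b'"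
  obtain F where F: "F \<in> top_faces" "Poly_Mapping.keys b \<subseteq> ridges F" and wb: "weight b = r"
    using b by (auto simp: vertices_hesd)
  obtain F' where F': "F' \<in> top_faces" "Poly_Mapping.keys b' \<subseteq> ridges F'" and wb': "weight b' = r"
    using b' by (auto simp: vertices_hesd)
  note fin = top_faceD(3)[OF F(1)] and fin' = top_faceD(3)[OF F'(1)]
  show "b = b'"
  proof (cases "F = F'")
    case True
    show ?thesis
    proof (rule poly_mapping_eqI)
      fix E
      show "Poly_Mapping.lookup b E = Poly_Mapping.lookup b' E"
      proof (cases "E \<in> ridges F")
        case True
        then obtain v where v: "v \<in> F" "E = F - {v}" by (auto simp: ridges_def)
        then show ?thesis
          using lookup_face_product_add[OF fin F(2) v(1)] F'(2) \<open>F = F'\<close> eq wb wb'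
            lookup_face_product_add[OF fin _ v(1), of b'] by simp
      next
        case False
        then have "E \<notin> Poly_Mapping.keys b" "E \<notin> Poly_Mapping.keys b'"
          using F(2) F'(2) True by auto
        then show ?thesis by (simp add: in_keys_iff)
      qed
    qed
  next
    case False
    have card: "card F = card F'" using F F' by (simp add: top_faceD)
    \<comment> \<open>Equal cardinality makes the faces incomparable. The common monomial is
      supported in their intersection, so it misses a vertex of each and both vectors are
      degenerate.\<close>
    have "\<not> F \<subseteq> F'" "\<not> F' \<subseteq> F"
      using False card_subset_eq[OF fin'] card_subset_eq[OF fin] card by auto
    then obtain v v' where v: "v \<in> F" "v \<notin> F'" and v': "v' \<in> F'" "v' \<notin> F" by blast
    have "b = Poly_Mapping.single (Poly_Mapping.keys (face_product b)) r"
      using keys_face_product[OF fin' F'(2)] eq v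
      by (intro vector_of_degenerate[OF wb fin F(2) v(1)]) auto
    moreover have "b' = Poly_Mapping.single (Poly_Mapping.keys (face_product b')) r"
      using keys_face_product[OF fin F(2)] eq v'
      by (intro vector_of_degenerate[OF wb' fin' F'(2) v'(1)]) auto
    ultimately show ?thesis using eq by metis
  qed
qed

lemma bij_betw_face_product: "bij_betw face_product (vertices H) (monomials (d * r))"
proof (rule bij_betw_imageI[OF inj_on_face_product], intro equalityI subsetI)
  fix m assume "m \<in> face_product ` vertices H"
  then obtain b F where b: "m = face_product b" "weight b = r" "F \<in> top_faces"
      "Poly_Mapping.keys b \<subseteq> ridges F"
    by (auto simp: vertices_hesd)
  note F = top_faceD[OF b(3)]
  have "Poly_Mapping.keys m \<in> \<Delta>"
    unfolding b(1) by (rule face_closed[OF F(1) keys_face_product[OF F(3) b(4)]])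
  moreover have "Poly_Mapping.lookup m v \<le> r" for v
    by (simp add: b(1,2) lookup_face_product[OF F(3) b(4)])
  moreover have "weight m = d * r"
    using weight_face_product[OF F(2) b(4)] b(1,2) by simp
  ultimately show "m \<in> monomials (d * r)" by (simp add: monomials_def)
next
  fix m assume "m \<in> monomials (d * r)"
  then have m: "Poly_Mapping.keys m \<in> \<Delta>" "\<And>v. Poly_Mapping.lookup m v \<le> r" "weight m = d * r"
    by (auto simp: monomials_def)
  obtain F where F: "F \<in> top_faces" "Poly_Mapping.keys m \<subseteq> F"
    using face_in_top_face[OF m(1)] by blast
  note fin = top_faceD(3)[OF F(1)]
  \<comment> \<open>The exponents of x_F^r divided by \<open>m\<close>, moved to the opposite
    ridges: the only choice compatible with \<open>lookup_face_product_add\<close>. Its weight is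
    (d+1)r - dr = r, for any top face containing the support.\<close>
  let ?b = "ridge_vector F (\<lambda>v. r - Poly_Mapping.lookup m v)"
  note keys = keys_ridge_vector[OF fin, of "\<lambda>v. r - Poly_Mapping.lookup m v"]
  have "weight ?b + weight m = (\<Sum>v\<in>F. (r - Poly_Mapping.lookup m v) + Poly_Mapping.lookup m v)"
    unfolding weight_ridge_vector weight_superset[OF fin F(2)] sum.distrib by simp
  also have "\<dots> = (d + 1) * r" using m(2) top_faceD(2)[OF F(1)] by simp
  finally have w: "weight ?b = r" using m(3) by simp
  have "face_product ?b = m"
  proof (rule poly_mapping_eqI)
    fix v
    show "Poly_Mapping.lookup (face_product ?b) v = Poly_Mapping.lookup m v"
    proof (cases "v \<in> F")
      case True
      then show ?thesis
        using lookup_face_product_add[OF fin keys True] lookup_ridge_vector[OF fin True] w m(2)[of v]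
        by simp
    next
      case False
      then show ?thesis using F(2) by (auto simp: lookup_face_product[OF fin keys] in_keys_iff)
    qed
  qed
  moreover have "?b \<in> vertices H"
    using w keys F(1) by (auto simp: vertices_hesd)
  ultimately show "m \<in> face_product ` vertices H" by (metis imageI)
qed

section \<open>Monomials of degree d r + 1 and their divisors\<close>

lemma lookup_top_monomial:
  assumes F: "F \<in> top_faces" and b: "Poly_Mapping.keys b \<subseteq> ridges F" "weight b + 1 = r"
  shows "Poly_Mapping.lookup (face_product b + face_exponent F) v =
    (if v \<in> F then r - Poly_Mapping.lookup b (F - {v}) else 0)"
  \<comment> \<open>The weight of \<open>b\<close> is r - 1, and x_F supplies the missing unit at
    each vertex; the subtraction is never truncated.\<close>
  using lookup_le_weight[of b "F - {v}"] b(2)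
  by (auto simp: lookup_add lookup_face_product[OF top_faceD(3)[OF F] b(1)]
      lookup_face_exponent[OF top_faceD(3)[OF F]])

lemma keys_top_monomial:
  assumes F: "F \<in> top_faces" and b: "Poly_Mapping.keys b \<subseteq> ridges F"
  shows "Poly_Mapping.keys (face_product b + face_exponent F) = F"
  using keys_face_product[OF top_faceD(3)[OF F] b] keys_face_exponent[OF top_faceD(3)[OF F]]
  by (auto simp: keys_add_nat)

lemma top_monomials_eq:
  "monomials (d * r + 1) = {face_product b + face_exponent F |F b.
    F \<in> top_faces \<and> Poly_Mapping.keys b \<subseteq> ridges F \<and> weight b + 1 = r}" (is "_ = ?M")
proof (intro equalityI subsetI)
  fix m assume "m \<in> ?M"
  then obtain F b where b: "F \<in> top_faces" "Poly_Mapping.keys b \<subseteq> ridges F" "weight b + 1 = r"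
      and m: "m = face_product b + face_exponent F" by blast
  note F = top_faceD[OF b(1)]
  have "weight (face_exponent F) = d + 1"
    using F(2) by (simp add: face_exponent_def weight_sum weight_single)
  then have "weight m = d * r + 1"
    unfolding b(3)[symmetric] using weight_face_product[OF F(2) b(2)] by (simp add: m weight_add)
  moreover have keys: "Poly_Mapping.keys m = F"
    unfolding m by (rule keys_top_monomial[OF b(1,2)])
  moreover have "Poly_Mapping.lookup m v \<le> r" for v
    by (simp add: m lookup_top_monomial[OF b])
  ultimately show "m \<in> monomials (d * r + 1)"
    using F(1) keys by (simp add: monomials_def)
next
  fix m assume "m \<in> monomials (d * r + 1)"
  then have m: "Poly_Mapping.keys m \<in> \<Delta>" "\<And>v. Poly_Mapping.lookup m v \<le> r" "weight m = d * r + 1"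
    by (auto simp: monomials_def)
  let ?F = "Poly_Mapping.keys m"
  have "weight m \<le> card ?F * r"
    unfolding weight_def using m(2) by (intro sum_bounded_above[where K = r, simplified]) auto
  then have "d * r < card ?F * r" using m(3) by linarith
  then have "d < card ?F" by simp
  then have F: "?F \<in> top_faces" using m(1) card_face_le[OF m(1)] by (simp add: top_faces_def)
  note fin = top_faceD(3)[OF F]
  \<comment> \<open>The same complement as in degree d r. The degree is one higher, so the weight
    drops to (d+1)r - (dr+1) = r - 1.\<close>
  let ?c = "\<lambda>v. r - Poly_Mapping.lookup m v"
  let ?b = "ridge_vector ?F ?c"
  note keys = keys_ridge_vector[OF fin, of ?c]
  have "weight ?b + weight m = (\<Sum>v\<in>?F. (r - Poly_Mapping.lookup m v) + Poly_Mapping.lookup m v)"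
    unfolding weight_ridge_vector weight_def[of m] sum.distrib by simp
  also have "\<dots> = (d + 1) * r" using m(2) top_faceD(2)[OF F] by simp
  finally have w: "weight ?b + 1 = r" using m(3) by simp
  have "m = face_product ?b + face_exponent ?F"
  proof (rule poly_mapping_eqI)
    fix v
    show "Poly_Mapping.lookup m v = Poly_Mapping.lookup (face_product ?b + face_exponent ?F) v"
      using m(2)[of v] lookup_ridge_vector[OF fin, of v ?c]
      by (auto simp: lookup_top_monomial[OF F keys w] in_keys_iff)
  qed
  then show "m \<in> ?M" using F keys w by blast
qed

text \<open>Defined from the monomial alone rather than from a pair of a face and a vector, so the
  map to facets involves no choice.\<close>

definition divisor_set :: "('v \<Rightarrow>\<^sub>0 nat) \<Rightarrow> ('v set \<Rightarrow>\<^sub>0 nat) set" where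
  "divisor_set m = {b \<in> vertices H. \<exists>v. m = face_product b + Poly_Mapping.single v 1}"

text \<open>Adding a unit at the ridge opposite to \<open>v\<close> raises the weight by one, hence
  every exponent on \<open>F\<close> except that of \<open>v\<close>; multiplying by x_v then makes
  up the full factor x_F.\<close>

lemma simplex_step:
  assumes F: "F \<in> top_faces" and b: "Poly_Mapping.keys b \<subseteq> ridges F" "weight b + 1 = r"
    and v: "v \<in> F"
  defines "x \<equiv> b + Poly_Mapping.single (F - {v}) 1"
  shows "x \<in> vertices H"
    and "face_product b + face_exponent F = face_product x + Poly_Mapping.single v 1"
proof -
  have x: "Poly_Mapping.keys x \<subseteq> ridges F" "weight x = r"
    using b v by (auto simp: x_def keys_add_nat weight_add weight_single ridges_def)
  then show "x \<in> vertices H" using F by (auto simp: vertices_hesd)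
  show "face_product b + face_exponent F = face_product x + Poly_Mapping.single v 1"
  proof (rule poly_mapping_eqI)
    fix w
    have "Poly_Mapping.lookup x (F - {w}) =
        Poly_Mapping.lookup b (F - {w}) + (if w = v then 1 else 0)" if "w \<in> F"
      using that v by (auto simp: x_def lookup_add lookup_single when_def)
    then show "Poly_Mapping.lookup (face_product b + face_exponent F) w =
        Poly_Mapping.lookup (face_product x + Poly_Mapping.single v 1) w"
      using v b(2) lookup_le_weight[of b "F - {w}"]
      unfolding lookup_top_monomial[OF F b] lookup_add[of "face_product x"]
        lookup_face_product[OF top_faceD(3)[OF F] x(1)] x(2)
      by (auto simp: lookup_single when_def)
  qed
qed

text \<open>The variable missing from a divisor lies in the support \<open>F\<close>, so the divisor
  is the monomial of a vertex of the simplex, and injectivity of \<open>face_product\<close>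
  identifies the vectors.\<close>

lemma divisor_set_top_monomial:
  assumes F: "F \<in> top_faces" and b: "Poly_Mapping.keys b \<subseteq> ridges F" "weight b + 1 = r"
  shows "divisor_set (face_product b + face_exponent F) = simplex F b"
proof (intro equalityI subsetI)
  fix x assume "x \<in> simplex F b"
  then obtain v where "v \<in> F" "x = b + Poly_Mapping.single (F - {v}) 1"
    by (auto simp: simplex_def)
  then show "x \<in> divisor_set (face_product b + face_exponent F)"
    using simplex_step[OF F b] by (auto simp: divisor_set_def)
next
  fix x assume "x \<in> divisor_set (face_product b + face_exponent F)"
  then obtain v where x: "x \<in> vertices H"
    and eq: "face_product b + face_exponent F = face_product x + Poly_Mapping.single v 1"
    by (auto simp: divisor_set_def)
  have "v \<in> Poly_Mapping.keys (face_product x + Poly_Mapping.single v 1)"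
    by (simp add: keys_add_nat)
  then have v: "v \<in> F" unfolding eq[symmetric] by (simp only: keys_top_monomial[OF F b(1)])
  let ?y = "b + Poly_Mapping.single (F - {v}) 1"
  have "face_product x = face_product ?y" using simplex_step(2)[OF F b v] eq by simp
  then have "x = ?y" by (rule inj_onD[OF inj_on_face_product _ x simplex_step(1)[OF F b v]])
  then show "x \<in> simplex F b" using v by (auto simp: simplex_def)
qed

text \<open>A monomial of degree \<open>d * r + 1\<close> is the least common multiple of its divisors of degree
  \<open>d * r\<close>, because it involves at least two variables.\<close>

lemma lookup_le_of_divisor_set:
  assumes m: "m \<in> monomials (d * r + 1)" and sub: "divisor_set m \<subseteq> divisor_set m'"
  shows "Poly_Mapping.lookup m w \<le> Poly_Mapping.lookup m' w"
proof -
  obtain F b where b: "F \<in> top_faces" "Poly_Mapping.keys b \<subseteq> ridges F" "weight b + 1 = r"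
    and m_eq: "m = face_product b + face_exponent F"
    using m unfolding top_monomials_eq by blast
  have "\<not> F \<subseteq> {w}"
    using top_faceD(4)[OF b(1)] card_mono[of "{w}" F] by auto
  \<comment> \<open>Dividing by a variable other than \<open>w\<close> keeps the exponent of
    \<open>w\<close>, so one common divisor already gives the bound.\<close>
  then obtain v where v: "v \<in> F" "v \<noteq> w" by blast
  let ?x = "b + Poly_Mapping.single (F - {v}) 1"
  have m_eq': "m = face_product ?x + Poly_Mapping.single v 1"
    unfolding m_eq by (rule simplex_step(2)[OF b v(1)])
  then have "?x \<in> divisor_set m" using simplex_step(1)[OF b v(1)] by (auto simp: divisor_set_def)
  then obtain u where "m' = face_product ?x + Poly_Mapping.single u 1"
    using sub by (auto simp: divisor_set_def)
  moreover have "Poly_Mapping.lookup m w = Poly_Mapping.lookup (face_product ?x) w"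
    unfolding m_eq' using v(2) by (simp add: lookup_add lookup_single when_def)
  ultimately show ?thesis by (simp add: lookup_add)
qed

lemma bij_betw_divisor_set: "bij_betw divisor_set (monomials (d * r + 1)) (facets H)"
proof (rule bij_betw_imageI)
  show "inj_on divisor_set (monomials (d * r + 1))"
    by (intro inj_onI poly_mapping_eqI antisym lookup_le_of_divisor_set) auto
  show "divisor_set ` monomials (d * r + 1) = facets H"
    unfolding top_monomials_eq facets_hesd
    using divisor_set_top_monomial by (auto simp: image_def) metis
qed

end

text \<open>Rows of the log matrix are indexed by minimal generators, so the facet
  \<open>\<psi> y\<close> enters through \<open>face_exponent\<close>; its bijectivity onto the
  generators ensures that every row is reached exactly once.\<close>

theorem theorem5p8:
  fixes n d a :: nat and \<Delta> :: "nat set set"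
    and R :: "(nat, 'k::field) mpoly ring" and J :: "(nat, 'k) mpoly set"
    and Q :: "('k, (nat, 'k) mpoly set) module"
    and L :: "(nat, 'k) mpoly"
    and H :: "(nat set \<Rightarrow>\<^sub>0 nat) set set" and I :: "(nat set \<Rightarrow>\<^sub>0 nat, 'k) mpoly set"
  assumes "simplicial_complex {1..n} \<Delta>" and "pure \<Delta>" and "complex_dim \<Delta> = int d"
    and "d \<ge> 1" and "a > 1"
    and "R = poly_ring {1..n}"
    and "J = stanley_reisner_ideal {1..n} \<Delta> <+>\<^bsub>R\<^esub> pure_power_ideal {1..n} a"
    and "Q = quotient_algebra {1..n} J"
    and "L = (\<Sum>i\<in>{1..n}. var i)"
    and "H = hesd (incidence_complex \<Delta> d) (a - 1)"
    and "I = facet_ideal H"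
  shows "\<exists>\<phi> \<psi>.
    bij_betw \<phi> (nonzero_monomials {1..n} J (d * (a - 1))) (vertices H) \<and>
    bij_betw \<psi> (nonzero_monomials {1..n} J (d * (a - 1) + 1)) (facets H) \<and>
    bij_betw face_exponent (facets H) (minimal_generators I) \<and>
    represents Q
      (graded_component {1..n} J (d * (a - 1))) (nonzero_monomials {1..n} J (d * (a - 1)))
      (graded_component {1..n} J (d * (a - 1) + 1)) (nonzero_monomials {1..n} J (d * (a - 1) + 1))
      (\<lambda>y x. of_nat (log_matrix I (face_exponent (\<psi> y)) (\<phi> x)))
      (\<lambda>X. (J +>\<^bsub>R\<^esub> L) \<otimes>\<^bsub>Q\<^esub> X)"
proof -
  define r where "r = a - 1"
  have a: "a = r + 1" and r: "r \<ge> 1" using \<open>a > 1\<close> by (auto simp: r_def)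
  let ?V = "{1..n}"
  let ?D1 = "{m :: nat \<Rightarrow>\<^sub>0 nat. Poly_Mapping.keys m \<notin> \<Delta>}"
  let ?D2 = "{m :: nat \<Rightarrow>\<^sub>0 nat. \<exists>v\<in>?V. a \<le> Poly_Mapping.lookup m v}"
  interpret C: pure_complex ?V \<Delta> d r
    using assms(1-4) r by unfold_locales
  have up1: "m + m' \<in> ?D1" if "m \<in> ?D1" for m m'
    using that C.face_closed[of "Poly_Mapping.keys (m + m')" "Poly_Mapping.keys m"]
    by (auto simp: keys_add_nat)
  have up2: "m + m' \<in> ?D2" if "m \<in> ?D2" for m m'
    using that by (auto simp: lookup_add intro: trans_le_add1)
  have J: "J = monomial_span ?V (?D1 \<union> ?D2)"
    unfolding assms(6,7) stanley_reisner_ideal_eq[OF assms(1)] pure_power_ideal_eq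
    using up1 up2 by (rule monomial_span_set_add)
  interpret M: monomial_quotient ?V "?D1 \<union> ?D2" J
    using up1 up2 by unfold_locales (simp, blast, rule J)
  have face_V: "F \<subseteq> ?V" if "F \<in> \<Delta>" for F
    using assms(1) that by (auto simp: simplicial_complex_def)
  \<comment> \<open>Where algebra and combinatorics meet: exponents below \<open>a = r + 1\<close>
    on \<open>V\<close> are exponents at most \<open>r\<close> everywhere, since those outside
    \<open>V\<close> vanish.\<close>
  have standard: "M.standard j = C.monomials j" for j
  proof (rule Set.set_eqI)
    fix m :: "nat \<Rightarrow>\<^sub>0 nat"
    have "(\<forall>v\<in>?V. Poly_Mapping.lookup m v < a) \<longleftrightarrow> (\<forall>v. Poly_Mapping.lookup m v \<le> r)"
      if "Poly_Mapping.keys m \<subseteq> ?V"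
    proof
      assume lt: "\<forall>v\<in>?V. Poly_Mapping.lookup m v < a"
      show "\<forall>v. Poly_Mapping.lookup m v \<le> r"
      proof
        fix v
        show "Poly_Mapping.lookup m v \<le> r"
        proof (cases "v \<in> ?V")
          case True
          then show ?thesis using lt a by fastforce
        next
          case False
          then have "v \<notin> Poly_Mapping.keys m" using that by blast
          then show ?thesis by (simp add: in_keys_iff)
        qed
      qed
    next
      assume "\<forall>v. Poly_Mapping.lookup m v \<le> r"
      then show "\<forall>v\<in>?V. Poly_Mapping.lookup m v < a" using a by (simp add: le_imp_less_Suc)
    qed
    then show "m \<in> M.standard j \<longleftrightarrow> m \<in> C.monomials j"
      using face_V[of "Poly_Mapping.keys m"]
      unfolding M.standard_def C.monomials_def by (auto simp: not_le)
  qed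
  let ?k = "\<lambda>m. M.coset (mon m)"
  let ?j = "d * r"
  have H: "H = C.H" using assms(10) by (simp add: r_def)
  have bij: "bij_betw (?k \<circ> face_product) (vertices H) (nonzero_monomials ?V J ?j)"
    unfolding H
    by (rule bij_betw_trans[OF C.bij_betw_face_product]) (rule M.bij_betw_standard[unfolded standard])
  \<comment> \<open>Both bijections pass through exponent vectors: a coset determines its standard
    monomial, which determines a vector or a set of divisors.\<close>
  define \<phi> where "\<phi> = inv_into (vertices H) (?k \<circ> face_product)"
  define \<psi> where "\<psi> = C.divisor_set \<circ> inv_into (C.monomials (?j + 1)) ?k"
  note bij' = M.bij_betw_standard[of "?j + 1", unfolded standard]
  have \<phi>: "bij_betw \<phi> (nonzero_monomials ?V J ?j) (vertices H)"
    unfolding \<phi>_def by (rule bij_betw_inv_into[OF bij])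
  have \<psi>: "bij_betw \<psi> (nonzero_monomials ?V J (?j + 1)) (facets H)"
    unfolding \<psi>_def H by (rule bij_betw_trans[OF bij_betw_inv_into[OF bij'] C.bij_betw_divisor_set])
  have fin: "finite F" if "F \<in> facets H" for F
    using that unfolding H by (rule C.finite_facet_hesd)
  have gens: "bij_betw face_exponent (facets H) (minimal_generators I)"
    unfolding assms(11) using fin by (rule bij_betw_face_exponent)
  have "represents M.Q
      (graded_component ?V J ?j) (nonzero_monomials ?V J ?j)
      (graded_component ?V J (?j + 1)) (nonzero_monomials ?V J (?j + 1))
      (\<lambda>y x. of_nat (log_matrix I (face_exponent (\<psi> y)) (\<phi> x)))
      (\<lambda>X. M.coset (\<Sum>v\<in>?V. var v) \<otimes>\<^bsub>M.Q\<^esub> X)"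
  proof (rule M.represents_linear_form, unfold standard)
    fix m m' assume m: "m \<in> C.monomials ?j" and m': "m' \<in> C.monomials (?j + 1)"
    obtain b where b: "b \<in> vertices H" "m = face_product b"
      using m C.bij_betw_face_product unfolding H bij_betw_def by blast
    have "\<phi> (?k m) = b"
      using bij_betw_inv_into_left[OF bij b(1)] by (simp add: \<phi>_def b(2))
    moreover have "\<psi> (?k m') = C.divisor_set m'"
      using bij_betw_inv_into_left[OF bij' m'] by (simp add: \<psi>_def)
    moreover have "C.divisor_set m' \<in> facets H"
      unfolding H using C.bij_betw_divisor_set m' by (rule bij_betw_apply)
    \<comment> \<open>The two matrices agree here: membership of a vertex in a facet is divisibility
      with a single variable as quotient.\<close>
    moreover have "b \<in> C.divisor_set m' \<longleftrightarrow> (\<exists>v. m' = m + Poly_Mapping.single v 1)"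
      using b by (simp add: C.divisor_set_def H)
    ultimately show "(of_nat (log_matrix I (face_exponent (\<psi> (?k m'))) (\<phi> (?k m))) :: 'k) =
        (if \<exists>v. m' = m + Poly_Mapping.single v 1 then 1 else 0)"
      unfolding assms(11) by (simp add: log_matrix_face_exponent fin)
  qed
  then show ?thesis
    using \<phi> \<psi> gens unfolding assms(6,8,9) r_def by blast
qed

end
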